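(* For $k\ge 10$, the atom $X(k)$ of the Binary Two-Up Sequence consists of the terms $a(n)$ to $a(n+7)$, where $n=12\mu(k+1)-11$. Let $x=\mu(k-1)-1$. Then $$a(n)=2^{4x+2}+2^{8x+5},\quad a(n+1)=2^{16x+10},\quad a(n+2)=2^{16x+11},\quad a(n+3)=2^{16x+12},$$ $$a(n+4)=2^{x}+2^{8x+6},\quad a(n+5)=2^{16x+13},\quad a(n+6)=2^{2x+1}+2^{4x+3},\quad a(n+7)=2^{16x+14}.$$ The next term after $X(k)$ ends is $a(n+8)=2^{s}+2^{8x+7}$, where $s=11$ if $k$ is even and $s=15$ if $k$ is odd.
   Context: Two nonnegative integers are perpendicular if their binary expansions have no $1$ in the same bit-position. The Binary Two-Up Sequence $\{a(n)\}_{n\ge 0}$ is defined by: for each $n\ge 0$, $a(n)$ is the smallest nonnegative integer not among $a(0),\ldots,a(n-1)$ that is perpendicular to each of $a(\lceil n/2\rceil),\ldots,a(n-1)$, i.e. to each of the previous $\lfloor n/2\rfloor$ terms. It begins $0,1,2,4,8,3,16,32,64,12,128,\ldots$. The initial term $a(0)=0$ is ignored in the decomposition below. The weight of a nonnegative integer is the number of $1$'s in its binary expansion. $\mu(m)$, $m\ge 1$, denotes the $m$-th term, in increasing order, of the sequence of all numbers of the form $2^i$ ($i\ge0$) or $3\cdot 2^i$ ($i\ge 0$): $\mu(1),\mu(2),\ldots = 1,2,3,4,6,8,12,16,24,32,48,64,\ldots$. Free $1$'s. When $n=2t$ is even, once $a(2t)$ has been determined the powers of $2$ in the binary expansion of $a(t)$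 are "freed". Thus the free powers of $2$ after step $n$ are the $2^e$ which occur in the binary expansion of some $a(i)$, $1\le i\le n$, but of none of the terms $a(\lceil (n+1)/2\rceil),\ldots,a(n)$. Atoms. The sequence $a(1),a(2),\ldots$ is cut into consecutive blocks called atoms: an atom ends with the term $a(n)$ exactly when, after step $n$ (including the freeing, if $n$ is even), there are exactly two distinct free powers of $2$ and their sum is a number not among $a(1),\ldots,a(n)$. The code of an atom is obtained by going through its terms $a(i)$ in order and writing $Aw$, where $w$ is the weight of $a(i)$, followed, if $i=2t$ is even, by $Fw'$, where $w'$ is the weight of the freed term $a(t)$. An atom is of type $X$ if its code is $A2\,A1\,F2\,A1\,A1\,F1\,A2\,A1\,F2\,A2\,A1\,F1$ (so it consists of $8$ terms). The atoms of type $X$ are numbered, in order of occurrence in the sequence, $X(2),X(3),X(4),\ldots$ (starting with $2$); e.g. $X(2)$ consists of $a(25),\ldots,a(32)$ and $X(3)$ of $a(37),\ldots,a(44)$. *)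

theory Defs
  imports Main "HOL-Library.Infinite_Set"
begin

definition perpendicular :: "nat \<Rightarrow> nat \<Rightarrow> bool" where
  "perpendicular m k \<longleftrightarrow> \<not> (\<exists>i. bit m i \<and> bit k i)"

definition weight :: "nat \<Rightarrow> nat" where
  "weight m = card {i. bit m i}"

(* (n + 1) div 2 is the ceiling of n/2.  The minimum exists, since only finitely many
   powers of 2 are excluded. *)
function two_up :: "nat \<Rightarrow> nat" where
  "two_up n = (LEAST m. m \<notin> two_up ` {..<n} \<and>
                         (\<forall>i\<in>{(n + 1) div 2..<n}. perpendicular m (two_up i)))"
  by auto
termination
  by (relation "measure id") auto

declare two_up.simps [simp del]

(* The index m of mu starts at 1, that of enumerate at 0. *)
definition mu :: "nat \<Rightarrow> nat" where
  "mu m = enumerate {v. (\<exists>i. v = 2 ^ i) \<or> (\<exists>i. v = 3 * 2 ^ i)} (m - 1)"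

(* (n + 2) div 2 is the ceiling of (n + 1)/2. *)
definition free_powers :: "nat \<Rightarrow> nat set" where
  "free_powers n = {2 ^ e | e. (\<exists>i\<in>{1..n}. bit (two_up i) e) \<and>
                               (\<forall>i\<in>{(n + 2) div 2..n}. \<not> bit (two_up i) e)}"

definition atom_end :: "nat \<Rightarrow> bool" where
  "atom_end n \<longleftrightarrow> 1 \<le> n \<and> card (free_powers n) = 2 \<and>
                  \<Sum>(free_powers n) \<notin> two_up ` {1..n}"

definition is_atom :: "nat \<Rightarrow> nat \<Rightarrow> bool" where
  "is_atom m n \<longleftrightarrow> 1 \<le> m \<and> m \<le> n \<and> (m = 1 \<or> atom_end (m - 1)) \<and>
                   atom_end n \<and> (\<forall>j\<in>{m..<n}. \<not> atom_end j)"

(* Allocated w and Freed w are the letters "Aw" and "Fw" of a code. *)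
datatype code_letter = Allocated nat | Freed nat

definition atom_code :: "nat \<Rightarrow> nat \<Rightarrow> code_letter list" where
  "atom_code m n = concat (map (\<lambda>i. Allocated (weight (two_up i)) #
      (if even i then [Freed (weight (two_up (i div 2)))] else [])) [m..<Suc n])"

definition is_X_atom :: "nat \<Rightarrow> nat \<Rightarrow> bool" where
  "is_X_atom m n \<longleftrightarrow> is_atom m n \<and>
     atom_code m n =
       [Allocated 2, Allocated 1, Freed 2, Allocated 1, Allocated 1, Freed 1,
        Allocated 2, Allocated 1, Freed 2, Allocated 2, Allocated 1, Freed 1]"

(* X_atom k m n: the atom X(k) consists of the terms with indices m, ..., n.
   The numbering starts with X(2), so X(k) is preceded by exactly k - 2 atoms of type X. *)
definition X_atom :: "nat \<Rightarrow> nat \<Rightarrow> nat \<Rightarrow> bool" where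
  "X_atom k m n \<longleftrightarrow> is_X_atom m n \<and>
     k = 2 + card {m'. m' < m \<and> (\<exists>n'. is_X_atom m' n')}"

end

theory Submission
  imports Defs "HOL-Library.Nat_Bijection"
begin

text \<open>
  After each step the exponents available to the next term are a small finite set \<open>F\<close> of freed
  exponents together with all \<open>e \<ge> N\<close>, where \<open>N\<close> is the least exponent never used. So the next term
  is the smallest unused sum over a subset of \<open>F\<close> if there is one, and \<open>2 ^ N\<close> otherwise. By this
  rule the terms with indices \<open>12 j + 1, \<dots>, 12 j + 12\<close> are determined by the terms with indices
  \<open>6 j + 1, \<dots>, 6 j + 6\<close>, which are freed meanwhile. Only two shapes of such blocks occur. The
  exceptional one, which contains an atom of type \<open>X\<close>, occurs exactly if \<open>j + 1\<close> is a value of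
  \<open>mu\<close>: its second half is freed during block \<open>2 j + 1\<close> and forces the exceptional shape there.
  A pair that is chosen is unused because it contains the exponent of a power of 2 freed just
  before, which lies in no earlier pair; the only other pair is the sum of \<open>2 ^ j\<close> and
  \<open>2 ^ (2 j + 1)\<close> in exceptional blocks. Since small blocks deviate from the pattern, the induction
  starts after the first 96 terms, which are computed by a verified simulation.
\<close>

section \<open>Sums of two powers of two\<close>

lemma set_decode_conv_bit: "set_decode m = {i. bit m i}"
  by (simp add: set_decode_def bit_iff_odd)

lemma bit_set_encode: "finite A \<Longrightarrow> bit (set_encode A) i \<longleftrightarrow> i \<in> A"
  using set_encode_inverse[of A] by (auto simp: set_decode_conv_bit)

lemma set_encode_less_power: "finite A \<Longrightarrow> A \<subseteq> {..<N} \<Longrightarrow> set_encode A < 2 ^ N"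
proof -
  assume "finite A" "A \<subseteq> {..<N}"
  then have "set_encode A \<le> (\<Sum>i<N. 2 ^ i)"
    unfolding set_encode_def by (auto intro: sum_mono2)
  also have "\<dots> < 2 ^ N"
    by (induction N) auto
  finally show ?thesis .
qed

lemma bit_imp_less: "bit (m::nat) i \<Longrightarrow> m < 2 ^ N \<Longrightarrow> i < N"
  by (metis bit_nat_iff bit_iff_odd div_less even_zero leI order_less_le_trans power_increasing one_le_numeral)

definition pair :: "nat \<Rightarrow> nat \<Rightarrow> nat" where
  "pair u v = 2 ^ u + 2 ^ v"

lemma pair_conv_set_encode: "u \<noteq> v \<Longrightarrow> pair u v = set_encode {u, v}"
  by (simp add: pair_def set_encode_def)

lemma set_encode_singleton: "set_encode {u} = 2 ^ u"
  by (simp add: set_encode_def)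

lemma pair_commute: "pair u v = pair v u"
  by (simp add: pair_def)

lemma bits_pair: "u \<noteq> v \<Longrightarrow> {i. bit (pair u v) i} = {u, v}"
  using set_encode_inverse[of "{u, v}"] by (simp add: pair_conv_set_encode set_decode_conv_bit)

lemma bits_power: "{i. bit ((2::nat) ^ u) i} = {u}"
  by (auto simp: bit_exp_iff)

lemma weight_pair: "u \<noteq> v \<Longrightarrow> weight (pair u v) = 2"
  by (simp add: weight_def bits_pair)

lemma weight_power: "weight (2 ^ u) = 1"
  by (simp add: weight_def bits_power)

lemma pair_neq_power: "u \<noteq> v \<Longrightarrow> pair u v \<noteq> 2 ^ e"
  using weight_pair[of u v] weight_power[of e] by auto

lemma pair_eq_iff:
  assumes "u < v" "u' < v'"
  shows "pair u v = pair u' v' \<longleftrightarrow> u = u' \<and> v = v'"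
proof
  assume "pair u v = pair u' v'"
  then have "{u, v} = {u', v'}"
    using assms bits_pair[of u v] bits_pair[of u' v'] by simp
  then show "u = u' \<and> v = v'"
    using assms by (auto simp: doubleton_eq_iff)
qed auto

section \<open>Available exponents\<close>

text \<open>With \<open>e\<close> above the sum of all earlier terms, \<open>2 ^ e\<close> exceeds
  each of them and shares no bit with any. So the \<open>LEAST\<close> in the recursion is
  attained.\<close>

lemma two_up_exists:
  "\<exists>m. m \<notin> two_up ` {..<n} \<and> (\<forall>i\<in>{(n + 1) div 2..<n}. perpendicular m (two_up i))"
proof -
  define e where "e = Suc (\<Sum>i<n. two_up i)"
  have less: "two_up i < 2 ^ e" if "i < n" for i
  proof -
    have "two_up i \<le> (\<Sum>i<n. two_up i)"
      using that by (intro member_le_sum) auto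
    then have "two_up i < e"
      by (simp add: e_def)
    also have "e < 2 ^ e"
      by (rule less_exp)
    finally show ?thesis .
  qed
  have "perpendicular (2 ^ e) (two_up i)" if "i < n" for i
    using bit_imp_less[OF _ less[OF that]] by (auto simp: perpendicular_def bit_exp_iff)
  moreover have "2 ^ e \<notin> two_up ` {..<n}"
    using less by fastforce
  ultimately show ?thesis
    by auto
qed

lemma two_up_perpendicular:
  "(n + 1) div 2 \<le> i \<Longrightarrow> i < n \<Longrightarrow> perpendicular (two_up n) (two_up i)"
  using LeastI_ex[OF two_up_exists[of n]] unfolding two_up.simps[of n, symmetric] by auto

section \<open>Exponents open to the next term, and how one step changes them\<close>

abbreviation "used n \<equiv> two_up ` {..n}"

text \<open>The window is the one seen by term \<open>n + 1\<close>; it starts at the ceiling of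
  \<open>(n + 1) / 2\<close>.\<close>

definition avail :: "nat \<Rightarrow> nat set" where
  "avail n = {e. \<forall>i\<in>{(n + 2) div 2..n}. \<not> bit (two_up i) e}"

lemma two_up_0: "two_up 0 = 0"
  by (subst two_up.simps) (auto simp: perpendicular_def)

text \<open>Perpendicularity to the window only restricts which bits may occur, so the minimum is
  taken over the codes of finite subsets of \<open>avail n\<close>.\<close>

lemma two_up_SucI:
  assumes "finite A" "A \<subseteq> avail n" "set_encode A \<notin> used n"
    and "\<And>B. finite B \<Longrightarrow> B \<subseteq> avail n \<Longrightarrow> set_encode B < set_encode A \<Longrightarrow> set_encode B \<in> used n"
  shows "two_up (Suc n) = set_encode A"
proof -
  have perp: "(\<forall>i\<in>{(Suc n + 1) div 2..<Suc n}. perpendicular m (two_up i)) \<longleftrightarrow> set_decode m \<subseteq> avail n" for m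
    by (auto simp: perpendicular_def avail_def set_decode_conv_bit atLeastLessThanSuc_atLeastAtMost)
  have "(LEAST m. m \<notin> two_up ` {..<Suc n} \<and>
      (\<forall>i\<in>{(Suc n + 1) div 2..<Suc n}. perpendicular m (two_up i))) = set_encode A"
  proof (rule Least_equality)
    show "set_encode A \<notin> two_up ` {..<Suc n} \<and>
      (\<forall>i\<in>{(Suc n + 1) div 2..<Suc n}. perpendicular (set_encode A) (two_up i))"
      unfolding perp using assms by (simp add: lessThan_Suc_atMost)
  next
    fix m
    assume m: "m \<notin> two_up ` {..<Suc n} \<and> (\<forall>i\<in>{(Suc n + 1) div 2..<Suc n}. perpendicular m (two_up i))"
    show "set_encode A \<le> m"
    proof (rule ccontr)
      assume "\<not> set_encode A \<le> m"
      then have "set_encode (set_decode m) \<in> used n"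
        using m unfolding perp by (intro assms(4)) auto
      then show False
        using m by (simp add: lessThan_Suc_atMost)
    qed
  qed
  then show ?thesis
    by (subst two_up.simps)
qed

definition freed :: "nat \<Rightarrow> nat set" where
  "freed n = (if even n then {e. bit (two_up (n div 2)) e} else {})"

text \<open>At an even index \<open>2 * t\<close> the window loses term \<open>t\<close>. All of the
  terms \<open>t + 1\<close> to \<open>2 * t\<close> were chosen perpendicular to it, so none of its
  bits is blocked by another term and all of them return. At an odd index the window only
  grows.\<close>

lemma avail_Suc: "avail (Suc n) = (avail n - {e. bit (two_up (Suc n)) e}) \<union> freed (Suc n)"
proof (cases "even n")
  case True
  then obtain t where n: "n = 2 * t"
    by auto
  have "{(Suc n + 2) div 2..Suc n} = insert (Suc n) {(n + 2) div 2..n}"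
    unfolding n by auto
  then show ?thesis
    using True by (auto simp: avail_def freed_def)
next
  case False
  then obtain s where s: "n = 2 * s + 1"
    by (auto elim: oddE)
  define t where "t = Suc s"
  have n: "Suc n = 2 * t"
    by (simp add: s t_def)
  have win: "{(Suc n + 2) div 2..Suc n} = {t + 1..2 * t}" "{(n + 2) div 2..n} = {t..<2 * t}"
    unfolding s t_def by auto
  have perp: "\<not> (bit (two_up i) e \<and> bit (two_up t) e)" if "i \<in> insert (2 * t) {t + 1..<2 * t}" for i e
  proof -
    have "perpendicular (two_up i) (two_up t)"
      using that by (intro two_up_perpendicular) (auto simp: t_def)
    then show ?thesis
      by (auto simp: perpendicular_def)
  qed
  have split: "{t + 1..2 * t} = insert (2 * t) {t + 1..<2 * t}" "{t..<2 * t} = insert t {t + 1..<2 * t}"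
    by (auto simp: t_def)
  define P where "P e \<longleftrightarrow> (\<forall>i\<in>{t + 1..<2 * t}. \<not> bit (two_up i) e)" for e
  have "freed (Suc n) = {e. bit (two_up t) e}"
    by (simp add: freed_def n)
  moreover have "avail (Suc n) = {e. \<not> bit (two_up (2 * t)) e \<and> P e}"
    unfolding avail_def win split by (auto simp: P_def)
  moreover have "avail n = {e. \<not> bit (two_up t) e \<and> P e}"
    unfolding avail_def win split by (auto simp: P_def)
  moreover have "P e" "\<not> bit (two_up (2 * t)) e" if "bit (two_up t) e" for e
    using perp that unfolding P_def by blast+
  ultimately show ?thesis
    unfolding n by auto
qed

definition state :: "nat \<Rightarrow> nat set \<Rightarrow> nat \<Rightarrow> bool" where
  "state n F N \<longleftrightarrow> F \<subseteq> {..<N} \<and> avail n = F \<union> {N..} \<and> (\<forall>e<N. 2 ^ e \<in> used n) \<and> (\<forall>m\<in>used n. m < 2 ^ N)"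

lemma state_0: "state 0 {} 0"
  by (auto simp: state_def avail_def two_up_0)

lemma state_finite: "state n F N \<Longrightarrow> finite F"
  by (auto simp: state_def intro: finite_subset)

lemma freed_less:
  assumes "state n F N"
  shows "freed (Suc n) \<subseteq> {..<N}"
proof
  fix e assume "e \<in> freed (Suc n)"
  then have *: "bit (two_up (Suc n div 2)) e"
    by (auto simp: freed_def split: if_splits)
  moreover have "Suc n div 2 \<le> n"
    by (cases n) auto
  ultimately show "e \<in> {..<N}"
    using assms bit_imp_less[OF *, of N] by (auto simp: state_def)
qed

text \<open>A number below \<open>2 ^ N\<close> with available bits is a sum over \<open>F\<close>.
  If all of these are used, the next candidate is \<open>2 ^ N\<close>, which exceeds every earlier
  term.\<close>

lemma state_new:
  assumes st: "state n F N" and all: "\<And>B. B \<subseteq> F \<Longrightarrow> set_encode B \<in> used n"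
  shows "two_up (Suc n) = 2 ^ N" "state (Suc n) (F \<union> freed (Suc n)) (Suc N)"
proof -
  have "two_up (Suc n) = set_encode {N}"
  proof (rule two_up_SucI)
    show "set_encode {N} \<notin> used n"
      using st by (auto simp: state_def set_encode_singleton)
  next
    fix B assume B: "finite B" "B \<subseteq> avail n" "set_encode B < set_encode {N}"
    then have "i < N" if "i \<in> B" for i
      using bit_imp_less[of "set_encode B" i N] that
      by (simp add: bit_set_encode set_encode_singleton)
    then have "B \<subseteq> F"
      using B st by (force simp: state_def)
    then show "set_encode B \<in> used n"
      by (rule all)
  qed (use st in \<open>auto simp: state_def\<close>)
  then show *: "two_up (Suc n) = 2 ^ N"
    by (simp add: set_encode_singleton)
  have parts: "F \<subseteq> {..<N}" "avail n = F \<union> {N..}" "\<forall>e<N. 2 ^ e \<in> used n" "\<forall>m\<in>used n. m < 2 ^ N"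
    using st by (auto simp: state_def)
  have used: "used (Suc n) = insert (2 ^ N) (used n)"
    by (simp add: atMost_Suc *)
  have "m < 2 ^ Suc N" if "m \<in> used n" for m
  proof -
    have "m < 2 ^ N"
      using parts(4) that by blast
    then show ?thesis
      by simp
  qed
  moreover have "F \<union> {N..} - {N} = F \<union> {Suc N..}"
    using parts(1) by auto
  ultimately show "state (Suc n) (F \<union> freed (Suc n)) (Suc N)"
    using freed_less[OF st] parts unfolding state_def avail_Suc * bits_power used
    by (auto simp: less_Suc_eq)
qed

text \<open>A sum over \<open>F\<close> is below \<open>2 ^ N\<close>, so its smaller competitors
  are sums over \<open>F\<close> as well.\<close>

lemma state_old:
  assumes st: "state n F N" and A: "A \<subseteq> F" "set_encode A \<notin> used n"
    and all: "\<And>B. B \<subseteq> F \<Longrightarrow> set_encode B < set_encode A \<Longrightarrow> set_encode B \<in> used n"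
  shows "two_up (Suc n) = set_encode A" "state (Suc n) (F - A \<union> freed (Suc n)) N"
proof -
  have fin: "finite A"
    using A(1) state_finite[OF st] by (rule finite_subset)
  have less: "set_encode A < 2 ^ N"
    using st A fin by (intro set_encode_less_power) (auto simp: state_def)
  show *: "two_up (Suc n) = set_encode A"
  proof (rule two_up_SucI[OF fin])
    fix B assume B: "finite B" "B \<subseteq> avail n" "set_encode B < set_encode A"
    then have "i < N" if "i \<in> B" for i
      using bit_imp_less[of "set_encode B" i N] that less by (simp add: bit_set_encode)
    then have "B \<subseteq> F"
      using B st by (force simp: state_def)
    then show "set_encode B \<in> used n"
      using B by (intro all)
  qed (use st A in \<open>auto simp: state_def\<close>)
  have bits: "{e. bit (set_encode A) e} = A"
    using fin by (auto simp: bit_set_encode)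
  have used: "used (Suc n) = insert (set_encode A) (used n)"
    by (simp add: atMost_Suc *)
  have "F \<union> {N..} - A = F - A \<union> {N..}"
    using st A(1) by (auto simp: state_def)
  then show "state (Suc n) (F - A \<union> freed (Suc n)) N"
    using freed_less[OF st] st A less unfolding state_def avail_Suc * bits used by auto
qed

text \<open>The exponents that have occurred are exactly those below \<open>N\<close>: each occurs
  in its own power of 2, and no term reaches \<open>2 ^ N\<close>.\<close>

lemma free_powers_state:
  assumes "state n F N"
  shows "free_powers n = (\<lambda>e. 2 ^ e) ` F"
proof -
  have "(\<exists>i\<in>{1..n}. bit (two_up i) e) \<longleftrightarrow> e < N" for e
  proof
    assume "e < N"
    then obtain i where "i \<le> n" "two_up i = 2 ^ e"
      using assms unfolding state_def by force
    then show "\<exists>i\<in>{1..n}. bit (two_up i) e"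
      by (intro bexI[of _ i]) (auto simp: bit_exp_iff Suc_le_eq two_up_0 intro!: gr0I)
  qed (use assms bit_imp_less in \<open>auto simp: state_def\<close>)
  then have "free_powers n = (\<lambda>e. 2 ^ e) ` ({..<N} \<inter> avail n)"
    unfolding free_powers_def avail_def by auto
  also have "{..<N} \<inter> avail n = F"
    using assms by (auto simp: state_def)
  finally show ?thesis .
qed

lemma atom_end_state:
  assumes "state n F N"
  shows "atom_end n \<longleftrightarrow> card F = 2 \<and> set_encode F \<notin> used n"
proof -
  have inj: "inj_on (\<lambda>e. 2 ^ e :: nat) F"
    by (auto intro: inj_onI)
  have card: "card (free_powers n) = card F"
    by (simp add: free_powers_state[OF assms] card_image inj)
  have sum: "\<Sum> (free_powers n) = set_encode F"
    by (simp add: free_powers_state[OF assms] sum.reindex inj set_encode_def)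
  \<comment> \<open>After step 0 only the term 0 is present, which forces \<open>N = 0\<close> and
    leaves \<open>F\<close> empty.\<close>
  have n: "1 \<le> n" if "card F = 2"
  proof (rule ccontr)
    assume "\<not> 1 \<le> n"
    then have "n = 0"
      by simp
    then have "\<forall>e<N. (2::nat) ^ e = 0"
      using assms by (auto simp: state_def two_up_0)
    then have "N = 0"
      by (cases N) (auto dest: spec[of _ 0])
    then show False
      using assms that by (auto simp: state_def)
  qed
  \<comment> \<open>\<open>used n\<close> also contains the ignored initial term 0, but the sum over
    a nonempty \<open>F\<close> is not 0.\<close>
  have "set_encode F \<in> used n \<longleftrightarrow> set_encode F \<in> two_up ` {1..n}" if "card F = 2"
  proof -
    have "F \<noteq> {}"
      using that by auto
    then have "set_encode F \<noteq> 0"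
      using set_encode_inverse[OF state_finite[OF assms]] by auto
    then show ?thesis
      using two_up_0 by (auto simp: image_iff Suc_le_eq intro!: bexI gr0I)
  qed
  then show ?thesis
    unfolding atom_end_def card sum using n by auto
qed

section \<open>A bound on the pairs used so far, and single steps between states\<close>

definition pairs_below :: "nat \<Rightarrow> nat \<Rightarrow> bool" where
  "pairs_below n T \<longleftrightarrow> (\<forall>m\<in>used n. m < 2 ^ T \<or> (\<exists>e. m = 2 ^ e))"

text \<open>The bound \<open>T\<close> certifies new pairs without inspecting the history: every
  used term that is not a power of 2 is below \<open>2 ^ T\<close>.\<close>

lemma pairs_below_fresh: "pairs_below n T \<Longrightarrow> T \<le> v \<Longrightarrow> u < v \<Longrightarrow> pair u v \<notin> used n"
proof
  assume *: "pairs_below n T" "T \<le> v" "u < v" "pair u v \<in> used n"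
  then have "pair u v < 2 ^ T"
    using pair_neq_power[of u v] unfolding pairs_below_def by fastforce
  moreover have "(2::nat) ^ T \<le> 2 ^ v"
    using * by (intro power_increasing) auto
  ultimately show False
    by (simp add: pair_def)
qed

lemma pairs_below_mono: "pairs_below n T \<Longrightarrow> T \<le> T' \<Longrightarrow> pairs_below n T'"
  unfolding pairs_below_def by (meson less_le_trans one_le_numeral power_increasing)

lemma pairs_below_Suc:
  "pairs_below n T \<Longrightarrow> two_up (Suc n) < 2 ^ T \<or> (\<exists>e. two_up (Suc n) = 2 ^ e) \<Longrightarrow> pairs_below (Suc n) T"
  by (auto simp: pairs_below_def atMost_Suc)

lemma pair_less_power: "u < v \<Longrightarrow> v < T \<Longrightarrow> pair u v < 2 ^ T"
proof -
  assume "u < v" "v < T"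
  then have "(2::nat) ^ u < 2 ^ v" "(2::nat) ^ Suc v \<le> 2 ^ T"
    by (auto intro: power_increasing simp del: power_Suc)
  then show ?thesis
    unfolding pair_def power_Suc by linarith
qed

definition full_state :: "nat \<Rightarrow> nat set \<Rightarrow> nat \<Rightarrow> nat \<Rightarrow> bool" where
  "full_state n F N T \<longleftrightarrow> state n F N \<and> pairs_below n T"

lemma usedI: "two_up i = m \<Longrightarrow> i \<le> n \<Longrightarrow> m \<in> used n"
  by auto

lemma used_mono: "m \<in> used n \<Longrightarrow> n \<le> n' \<Longrightarrow> m \<in> used n'"
  by auto

lemma zero_used: "0 \<in> used n"
  by (rule usedI[OF two_up_0]) simp

lemma used_subset_pair:
  assumes "state n F N" "B \<subseteq> F" "B \<subseteq> {u, v}" "B \<noteq> {u, v}"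
  shows "set_encode B \<in> used n"
proof -
  have "B = {} \<or> B = {u} \<or> B = {v}"
    using assms(3,4) by auto
  moreover have "2 ^ e \<in> used n" if "e \<in> B" for e
    using that assms(1,2) by (auto simp: state_def)
  ultimately show ?thesis
    using zero_used by (auto simp: set_encode_singleton)
qed

text \<open>With at most two free exponents, the sums over \<open>F\<close> are 0, single powers
  below \<open>2 ^ N\<close> and at most one pair. Only the pair needs to be checked.\<close>

lemma new_step:
  assumes st: "full_state n F N T" and card: "card F \<le> 2"
    and pairs: "\<forall>u\<in>F. \<forall>v\<in>F. u < v \<longrightarrow> pair u v \<in> used n"
  shows "two_up (Suc n) = 2 ^ N \<and> full_state (Suc n) (F \<union> freed (Suc n)) (Suc N) T"
proof -
  have state: "state n F N" and pairs_below: "pairs_below n T"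
    using st by (auto simp: full_state_def)
  note fin = state_finite[OF state]
  have all: "set_encode B \<in> used n" if sub: "B \<subseteq> F" for B
  proof (cases "card B = 2")
    case True
    then obtain u v where "B = {u, v}" "u < v"
      by (metis card_2_iff insert_commute linorder_neqE_nat)
    then show ?thesis
      using pairs sub by (auto simp: pair_conv_set_encode)
  next
    case False
    moreover have "card B \<le> 2"
      using card_mono[OF fin that] card by simp
    ultimately have "card B = 0 \<or> card B = 1"
      by linarith
    then consider "B = {}" | u where "B = {u}"
      using finite_subset[OF sub fin] by (auto simp: card_1_singleton_iff)
    then show ?thesis
    proof cases
      case 1
      then show ?thesis
        using zero_used by simp
    next
      case 2
      then show ?thesis
        using sub used_subset_pair[OF state sub, of u "Suc u"] by auto
    qed
  qed
  show ?thesis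
    using state_new[OF state all] pairs_below by (auto simp: full_state_def intro!: pairs_below_Suc)
qed

lemma new_odd:
  assumes "full_state n F N T" "m = Suc n" "N' = Suc N" "odd m" "card F \<le> 2"
    and "\<forall>u\<in>F. \<forall>v\<in>F. u < v \<longrightarrow> pair u v \<in> used n"
  shows "two_up m = 2 ^ N \<and> full_state m F N' T"
  using new_step[OF assms(1,5,6)] assms(2-4) by (simp add: freed_def)

lemma new_even:
  assumes "full_state n F N T" "m = Suc n" "N' = Suc N" "m = 2 * t" "{e. bit (two_up t) e} = G"
    and "F' = F \<union> G" "card F \<le> 2"
    and "\<forall>u\<in>F. \<forall>v\<in>F. u < v \<longrightarrow> pair u v \<in> used n"
  shows "two_up m = 2 ^ N \<and> full_state m F' N' T"
proof -
  have "freed m = G"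
    using assms(4,5) by (simp add: freed_def)
  then show ?thesis
    using new_step[OF assms(1,7,8)] assms(2,3,6) by simp
qed

text \<open>The proper subsets of \<open>{u, v}\<close> give 0 and single powers, all used, and the
  pair itself is new by the bound \<open>T\<close>. Nothing is freed at an odd index, so no free
  exponent remains.\<close>

lemma pair_odd:
  assumes st: "full_state n {u, v} N T" and m: "m = Suc n" "odd m" and uv: "u < v" "T \<le> v" "T' = Suc v"
  shows "two_up m = pair u v \<and> full_state m {} N T'"
proof -
  have state: "state n {u, v} N" and pairs_below: "pairs_below n T"
    using st by (auto simp: full_state_def)
  have pair: "pair u v = set_encode {u, v}"
    using uv by (simp add: pair_conv_set_encode)
  have fresh: "set_encode {u, v} \<notin> used n"
    using pairs_below_fresh[OF pairs_below uv(2,1)] pair by simp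
  have all: "set_encode B \<in> used n" if "B \<subseteq> {u, v}" "set_encode B < set_encode {u, v}" for B
    using that by (intro used_subset_pair[OF state]) auto
  note * = state_old[OF state subset_refl fresh all]
  have "pairs_below m T'"
    using pairs_below_mono[OF pairs_below, of T'] uv pair_less_power[OF uv(1), of T'] *(1) pair unfolding m(1)
    by (intro pairs_below_Suc) auto
  then show ?thesis
    using * m pair by (simp add: full_state_def freed_def)
qed

text \<open>Either order of \<open>y\<close> and \<open>c\<close> is allowed: if \<open>c < y\<close>, then \<open>pair c r\<close> is the smaller candidate.\<close>

lemma triple_odd:
  assumes st: "full_state n {y, c, r} N T" and m: "m = Suc n" "odd m"
    and less: "y < r" "c < r" "y \<noteq> c" and T': "T \<le> T'" "r < T'"
    and used: "pair y c \<in> used n" "pair c r \<in> used n \<or> y < c" and fresh: "pair y r \<notin> used n"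
  shows "two_up m = pair y r \<and> full_state m {c} N T'"
proof -
  have state: "state n {y, c, r} N" and pairs_below: "pairs_below n T"
    using st by (auto simp: full_state_def)
  have pair: "pair y r = set_encode {y, r}"
    using less by (simp add: pair_conv_set_encode)
  have fresh': "set_encode {y, r} \<notin> used n"
    using fresh pair by simp
  have all: "set_encode B \<in> used n" if B: "B \<subseteq> {y, c, r}" "set_encode B < set_encode {y, r}" for B
  proof -
    consider "B \<subseteq> {y, r}" | "B \<subseteq> {y, c}" "c \<in> B" | "B = {c, r}" | "B = {y, c, r}"
      using B(1) by blast
    then show ?thesis
    proof cases
      case 1
      then show ?thesis
        using B by (intro used_subset_pair[OF state B(1), of y r]) auto
    next
      case 2
      then show ?thesis
        using B used(1) pair_conv_set_encode[OF less(3)]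
        by (cases "B = {y, c}") (auto intro: used_subset_pair[OF state B(1), of y c])
    next
      case 3
      have "\<not> y < c"
      proof
        assume "y < c"
        then have "(2::nat) ^ y < 2 ^ c"
          by simp
        then show False
          using B(2) 3 less by (simp add: set_encode_def)
      qed
      then show ?thesis
        using 3 used(2) less pair_conv_set_encode[of c r] by simp
    next
      case 4
      then show ?thesis
        using B(2) less by (simp add: set_encode_def)
    qed
  qed
  note * = state_old[OF state _ fresh' all]
  have "pairs_below m T'"
    using pairs_below_mono[OF pairs_below, of T'] T' pair_less_power[OF less(1) T'(2)] *(1) pair unfolding m(1)
    by (intro pairs_below_Suc) auto
  moreover have "{y, c, r} - {y, r} = {c}"
    using less by auto
  ultimately show ?thesis
    using * m pair by (simp add: full_state_def freed_def)
qed

lemma not_atom_end_card: "full_state n F N T \<Longrightarrow> card F \<noteq> 2 \<Longrightarrow> \<not> atom_end n"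
  by (auto simp: full_state_def atom_end_state)

lemma not_atom_end_used: "full_state n {u, v} N T \<Longrightarrow> u \<noteq> v \<Longrightarrow> pair u v \<in> used n \<Longrightarrow> \<not> atom_end n"
  by (auto simp: full_state_def atom_end_state pair_conv_set_encode)

lemma atom_end_fresh: "full_state n {u, v} N T \<Longrightarrow> u < v \<Longrightarrow> T \<le> v \<Longrightarrow> atom_end n"
  using pairs_below_fresh[of n T v u] by (auto simp: full_state_def atom_end_state pair_conv_set_encode)

section \<open>Blocks of twelve terms\<close>

text \<open>Six terms are grouped because block \<open>j\<close>, with indices
  \<open>12 * j + 1\<close> to \<open>12 * j + 12\<close>, frees exactly half \<open>j\<close> and
  creates the halves \<open>2 * j\<close> and \<open>2 * j + 1\<close>. The smaller exponents of the
  pairs are left open: a regular block needs only bounds on them.\<close>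

definition reg_half :: "nat \<Rightarrow> bool" where
  "reg_half i \<longleftrightarrow> (\<exists>p p'. p < 2 * i + 1 \<and> p' < 2 * i + 2 \<and>
     two_up (6 * i + 1) = pair p (2 * i + 1) \<and> two_up (6 * i + 2) = 2 ^ (4 * i + 2) \<and>
     two_up (6 * i + 3) = 2 ^ (4 * i + 3) \<and> two_up (6 * i + 4) = 2 ^ (4 * i + 4) \<and>
     two_up (6 * i + 5) = pair p' (2 * i + 2) \<and> two_up (6 * i + 6) = 2 ^ (4 * i + 5))"

text \<open>The exponents are parameters here because they are passed on: an exceptional half
  \<open>i\<close> with \<open>p\<close>, \<open>q\<close>, \<open>c\<close> leads to the half
  \<open>2 * i + 1\<close> with \<open>q\<close>, \<open>2 * i + 1\<close>,
  \<open>c\<close>.\<close>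

definition exc_half :: "nat \<Rightarrow> nat \<Rightarrow> nat \<Rightarrow> nat \<Rightarrow> bool" where
  "exc_half i p q c \<longleftrightarrow>
     two_up (6 * i + 1) = pair p q \<and> two_up (6 * i + 2) = 2 ^ (4 * i + 2) \<and>
     two_up (6 * i + 3) = pair c (2 * i + 1) \<and> two_up (6 * i + 4) = 2 ^ (4 * i + 3) \<and>
     two_up (6 * i + 5) = 2 ^ (4 * i + 4) \<and> two_up (6 * i + 6) = 2 ^ (4 * i + 5)"

lemma double_index:
  "6 * (2 * j) + r = 12 * j + r" "4 * (2 * j) + r = 8 * j + r" "2 * (2 * j) + r = 4 * j + r"
  "6 * (2 * j + 1) + 1 = 12 * j + 7" "6 * (2 * j + 1) + 2 = 12 * j + 8"
  "6 * (2 * j + 1) + 3 = 12 * j + 9" "6 * (2 * j + 1) + 4 = 12 * j + 10"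
  "6 * (2 * j + 1) + 5 = 12 * j + 11" "6 * (2 * j + 1) + 6 = 12 * j + 12"
  "4 * (2 * j + 1) + 2 = 8 * j + 6" "4 * (2 * j + 1) + 3 = 8 * j + 7"
  "4 * (2 * j + 1) + 4 = 8 * j + 8" "4 * (2 * j + 1) + 5 = 8 * j + 9"
  "2 * (2 * j + 1) + 1 = 4 * j + 3" "2 * (2 * j + 1) + 2 = 4 * j + 4" for j r :: nat
  by simp_all

text \<open>Halves of both shapes begin with a pair and \<open>2 ^ (4 * j + 2)\<close>, so the
  blocks freeing them begin alike. The freed pair of \<open>p\<close> and \<open>q\<close> is itself
  a used term, so two new powers follow, until \<open>4 * j + 2\<close> is freed and combines with
  the smaller exponent \<open>p\<close>. What is left is \<open>q\<close>.\<close>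

lemma block_start:
  assumes s0: "full_state (12 * j) {C, 4 * j + 1} (8 * j + 2) (4 * j + 1)" and C: "C < 4 * j + 1"
    and h1: "two_up (6 * j + 1) = pair p q" and h2: "two_up (6 * j + 2) = 2 ^ (4 * j + 2)"
    and pq: "p < q" "q < 4 * j + 2"
  shows "two_up (12 * j + 1) = pair C (4 * j + 1)" "two_up (12 * j + 2) = 2 ^ (8 * j + 2)"
    "two_up (12 * j + 3) = 2 ^ (8 * j + 3)" "two_up (12 * j + 4) = 2 ^ (8 * j + 4)"
    "two_up (12 * j + 5) = pair p (4 * j + 2)" "full_state (12 * j + 5) {q} (8 * j + 5) (4 * j + 3)"
    "\<forall>n\<in>{12 * j + 1..12 * j + 5}. \<not> atom_end n"
proof -
  have used: "pair p q \<in> used n" if "6 * j + 1 \<le> n" for n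
    using usedI[OF h1 that] .
  have b1: "{e. bit (two_up (6 * j + 1)) e} = {p, q}"
    unfolding h1 by (rule bits_pair) (use pq in simp)
  have b2: "{e. bit (two_up (6 * j + 2)) e} = {4 * j + 2}"
    by (simp only: h2 bits_power)
  have 1: "two_up (12 * j + 1) = pair C (4 * j + 1) \<and> full_state (12 * j + 1) {} (8 * j + 2) (4 * j + 2)"
    by (rule pair_odd[OF s0]) (use C in auto)
  have 2: "two_up (12 * j + 2) = 2 ^ (8 * j + 2) \<and> full_state (12 * j + 2) {p, q} (8 * j + 3) (4 * j + 2)"
    by (rule new_even[OF conjunct2[OF 1] _ _ _ b1]) auto
  have 3: "two_up (12 * j + 3) = 2 ^ (8 * j + 3) \<and> full_state (12 * j + 3) {p, q} (8 * j + 4) (4 * j + 2)"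
    by (rule new_odd[OF conjunct2[OF 2]]) (use pq used in \<open>auto simp: card_insert_if\<close>)
  have 4: "two_up (12 * j + 4) = 2 ^ (8 * j + 4) \<and>
      full_state (12 * j + 4) {p, q, 4 * j + 2} (8 * j + 5) (4 * j + 2)"
    by (rule new_even[OF conjunct2[OF 3] _ _ _ b2]) (use pq used in \<open>auto simp: card_insert_if\<close>)
  have fresh: "pair p (4 * j + 2) \<notin> used (12 * j + 4)"
    using 4 pq by (intro pairs_below_fresh[of _ "4 * j + 2"]) (auto simp: full_state_def)
  have 5: "two_up (12 * j + 5) = pair p (4 * j + 2) \<and> full_state (12 * j + 5) {q} (8 * j + 5) (4 * j + 3)"
    by (rule triple_odd[OF conjunct2[OF 4]]) (use pq used fresh in auto)
  have e: "\<not> atom_end (12 * j + 1)" "\<not> atom_end (12 * j + 2)" "\<not> atom_end (12 * j + 3)"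
    "\<not> atom_end (12 * j + 4)" "\<not> atom_end (12 * j + 5)"
    using not_atom_end_card[OF conjunct2[OF 1]] not_atom_end_used[OF conjunct2[OF 2]]
      not_atom_end_used[OF conjunct2[OF 3]] not_atom_end_card[OF conjunct2[OF 4]]
      not_atom_end_card[OF conjunct2[OF 5]] pq used by auto
  have "{12 * j + 1..12 * j + 5} = {12 * j + 1, 12 * j + 2, 12 * j + 3, 12 * j + 4, 12 * j + 5}"
    by auto
  with e show "\<forall>n\<in>{12 * j + 1..12 * j + 5}. \<not> atom_end n"
    by simp
  show "two_up (12 * j + 1) = pair C (4 * j + 1)" "two_up (12 * j + 2) = 2 ^ (8 * j + 2)"
    "two_up (12 * j + 3) = 2 ^ (8 * j + 3)" "two_up (12 * j + 4) = 2 ^ (8 * j + 4)"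
    "two_up (12 * j + 5) = pair p (4 * j + 2)" "full_state (12 * j + 5) {q} (8 * j + 5) (4 * j + 3)"
    using 1 2 3 4 5 by blast+
qed

text \<open>The leftover \<open>2 * j + 1\<close> combines with the freed \<open>4 * j + 3\<close>,
  which gives the atom end inside the block. Later \<open>p'\<close> combines with
  \<open>4 * j + 4\<close> and leaves \<open>2 * j + 2\<close>, which together with
  \<open>4 * j + 5\<close> opens the next block.\<close>

lemma regular_block:
  assumes s0: "full_state (12 * j) {C, 4 * j + 1} (8 * j + 2) (4 * j + 1)" and C: "C < 4 * j + 1"
    and "reg_half j"
  shows "reg_half (2 * j)" "reg_half (2 * j + 1)"
    "full_state (12 * Suc j) {2 * Suc j, 4 * Suc j + 1} (8 * Suc j + 2) (4 * Suc j + 1)"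
    "\<forall>n\<in>{12 * j<..<12 * j + 12}. atom_end n \<longleftrightarrow> n = 12 * j + 6"
proof -
  obtain p p' where p: "p < 2 * j + 1" "p' < 2 * j + 2"
    and h1: "two_up (6 * j + 1) = pair p (2 * j + 1)" and h2: "two_up (6 * j + 2) = 2 ^ (4 * j + 2)"
    and h3: "two_up (6 * j + 3) = 2 ^ (4 * j + 3)" and h4: "two_up (6 * j + 4) = 2 ^ (4 * j + 4)"
    and h5: "two_up (6 * j + 5) = pair p' (2 * j + 2)" and h6: "two_up (6 * j + 6) = 2 ^ (4 * j + 5)"
    using \<open>reg_half j\<close> unfolding reg_half_def by blast
  note start = block_start[OF s0 C h1 h2 p(1)]
  have 5: "full_state (12 * j + 5) {2 * j + 1} (8 * j + 5) (4 * j + 3)"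
    by (rule start(6)) simp
  have b3: "{e. bit (two_up (6 * j + 3)) e} = {4 * j + 3}"
    by (simp only: h3 bits_power)
  have b4: "{e. bit (two_up (6 * j + 4)) e} = {4 * j + 4}"
    by (simp only: h4 bits_power)
  have b5: "{e. bit (two_up (6 * j + 5)) e} = {p', 2 * j + 2}"
    using p by (simp add: h5 bits_pair)
  have b6: "{e. bit (two_up (6 * j + 6)) e} = {4 * j + 5}"
    by (simp only: h6 bits_power)
  have used: "pair p' (2 * j + 2) \<in> used n" if "6 * j + 5 \<le> n" for n
    using usedI[OF h5 that] .
  have 6: "two_up (12 * j + 6) = 2 ^ (8 * j + 5) \<and>
      full_state (12 * j + 6) {2 * j + 1, 4 * j + 3} (8 * j + 6) (4 * j + 3)"
    by (rule new_even[OF 5 _ _ _ b3]) auto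
  have 7: "two_up (12 * j + 7) = pair (2 * j + 1) (4 * j + 3) \<and> full_state (12 * j + 7) {} (8 * j + 6) (4 * j + 4)"
    by (rule pair_odd[OF conjunct2[OF 6]]) auto
  have 8: "two_up (12 * j + 8) = 2 ^ (8 * j + 6) \<and> full_state (12 * j + 8) {4 * j + 4} (8 * j + 7) (4 * j + 4)"
    by (rule new_even[OF conjunct2[OF 7] _ _ _ b4]) auto
  have 9: "two_up (12 * j + 9) = 2 ^ (8 * j + 7) \<and> full_state (12 * j + 9) {4 * j + 4} (8 * j + 8) (4 * j + 4)"
    by (rule new_odd[OF conjunct2[OF 8]]) auto
  have 10: "two_up (12 * j + 10) = 2 ^ (8 * j + 8) \<and>
      full_state (12 * j + 10) {p', 2 * j + 2, 4 * j + 4} (8 * j + 9) (4 * j + 4)"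
    by (rule new_even[OF conjunct2[OF 9] _ _ _ b5]) auto
  have fresh: "pair p' (4 * j + 4) \<notin> used (12 * j + 10)"
    using 10 p by (intro pairs_below_fresh[of _ "4 * j + 4"]) (auto simp: full_state_def)
  have 11: "two_up (12 * j + 11) = pair p' (4 * j + 4) \<and>
      full_state (12 * j + 11) {2 * j + 2} (8 * j + 9) (4 * j + 5)"
    by (rule triple_odd[OF conjunct2[OF 10]]) (use p used fresh in auto)
  have 12: "two_up (12 * j + 12) = 2 ^ (8 * j + 9) \<and>
      full_state (12 * j + 12) {2 * j + 2, 4 * j + 5} (8 * j + 10) (4 * j + 5)"
    by (rule new_even[OF conjunct2[OF 11] _ _ _ b6]) auto
  show "reg_half (2 * j)"
    unfolding reg_half_def double_index
    by (rule exI[of _ C], rule exI[of _ p]) (use start(1-5) p C 6 in simp)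
  show "reg_half (2 * j + 1)"
    unfolding reg_half_def double_index
    by (rule exI[of _ "2 * j + 1"], rule exI[of _ p']) (use p 7 8 9 10 11 12 in simp)
  show "full_state (12 * Suc j) {2 * Suc j, 4 * Suc j + 1} (8 * Suc j + 2) (4 * Suc j + 1)"
    using 12 by (simp add: algebra_simps)
  have e: "atom_end (12 * j + 6)" "\<not> atom_end (12 * j + 7)" "\<not> atom_end (12 * j + 8)"
    "\<not> atom_end (12 * j + 9)" "\<not> atom_end (12 * j + 10)" "\<not> atom_end (12 * j + 11)"
    using atom_end_fresh[OF conjunct2[OF 6]] not_atom_end_card[OF conjunct2[OF 7]]
      not_atom_end_card[OF conjunct2[OF 8]] not_atom_end_card[OF conjunct2[OF 9]]
      not_atom_end_card[OF conjunct2[OF 10]] not_atom_end_card[OF conjunct2[OF 11]] p by auto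
  have "{12 * j<..<12 * j + 12} = {12 * j + 1..12 * j + 5} \<union>
      {12 * j + 6, 12 * j + 7, 12 * j + 8, 12 * j + 9, 12 * j + 10, 12 * j + 11}"
    by auto
  with e start(7) show "\<forall>n\<in>{12 * j<..<12 * j + 12}. atom_end n \<longleftrightarrow> n = 12 * j + 6"
    by auto
qed

text \<open>Freeing \<open>c\<close> and \<open>2 * j + 1\<close> beside the leftover
  \<open>q\<close> yields three exponents. The pairs containing \<open>c\<close> are used, so
  \<open>q\<close> combines with \<open>2 * j + 1\<close>, and \<open>c\<close> waits for
  \<open>4 * j + 3\<close>. As \<open>2 * j + 1\<close> lies below the bound \<open>T\<close>, the
  newness of that pair is a separate hypothesis. It may assume \<open>reg_half (2 * j)\<close>,
  since its proof has to inspect the half built in this very block.\<close>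

lemma exceptional_block:
  assumes s0: "full_state (12 * j) {C, 4 * j + 1} (8 * j + 2) (4 * j + 1)" and C: "C < 4 * j + 1"
    and "exc_half j p q c"
    and pqc: "p < q" "q < 2 * j + 1" "c < 2 * j + 1" "q \<noteq> c"
    and used: "pair q c \<in> used (12 * j)"
    and unused: "reg_half (2 * j) \<Longrightarrow> pair q (2 * j + 1) \<notin> used (12 * j + 6)"
  shows "two_up (12 * j + 1) = pair C (4 * j + 1)" "two_up (12 * j + 5) = pair p (4 * j + 2)"
    "reg_half (2 * j)" "exc_half (2 * j + 1) q (2 * j + 1) c"
    "full_state (12 * Suc j) {4 * Suc j, 4 * Suc j + 1} (8 * Suc j + 2) (4 * Suc j + 1)"
    "\<forall>n\<in>{12 * j<..<12 * j + 12}. atom_end n \<longleftrightarrow> n = 12 * j + 8"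
proof -
  have h1: "two_up (6 * j + 1) = pair p q" and h2: "two_up (6 * j + 2) = 2 ^ (4 * j + 2)"
    and h3: "two_up (6 * j + 3) = pair c (2 * j + 1)" and h4: "two_up (6 * j + 4) = 2 ^ (4 * j + 3)"
    and h5: "two_up (6 * j + 5) = 2 ^ (4 * j + 4)" and h6: "two_up (6 * j + 6) = 2 ^ (4 * j + 5)"
    using \<open>exc_half j p q c\<close> unfolding exc_half_def by blast+
  note start = block_start[OF s0 C h1 h2 pqc(1)]
  have 5: "full_state (12 * j + 5) {q} (8 * j + 5) (4 * j + 3)"
    by (rule start(6)) (use pqc in simp)
  have b3: "{e. bit (two_up (6 * j + 3)) e} = {c, 2 * j + 1}"
    using pqc by (simp add: h3 bits_pair)
  have b4: "{e. bit (two_up (6 * j + 4)) e} = {4 * j + 3}"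
    by (simp only: h4 bits_power)
  have b5: "{e. bit (two_up (6 * j + 5)) e} = {4 * j + 4}"
    by (simp only: h5 bits_power)
  have b6: "{e. bit (two_up (6 * j + 6)) e} = {4 * j + 5}"
    by (simp only: h6 bits_power)
  have 6: "two_up (12 * j + 6) = 2 ^ (8 * j + 5) \<and>
      full_state (12 * j + 6) {q, c, 2 * j + 1} (8 * j + 6) (4 * j + 3)"
    by (rule new_even[OF 5 _ _ _ b3]) auto
  show half: "reg_half (2 * j)"
    unfolding reg_half_def double_index
    by (rule exI[of _ C], rule exI[of _ p]) (use start(1-5) pqc C 6 in simp)
  have used': "pair q c \<in> used (12 * j + 6)" "pair c (2 * j + 1) \<in> used (12 * j + 6)"
    using used used_mono usedI[OF h3] by auto
  have 7: "two_up (12 * j + 7) = pair q (2 * j + 1) \<and> full_state (12 * j + 7) {c} (8 * j + 6) (4 * j + 3)"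
    by (rule triple_odd[OF conjunct2[OF 6]]) (use pqc used' unused[OF half] in auto)
  have 8: "two_up (12 * j + 8) = 2 ^ (8 * j + 6) \<and> full_state (12 * j + 8) {c, 4 * j + 3} (8 * j + 7) (4 * j + 3)"
    by (rule new_even[OF conjunct2[OF 7] _ _ _ b4]) auto
  have 9: "two_up (12 * j + 9) = pair c (4 * j + 3) \<and> full_state (12 * j + 9) {} (8 * j + 7) (4 * j + 4)"
    by (rule pair_odd[OF conjunct2[OF 8]]) (use pqc in auto)
  have 10: "two_up (12 * j + 10) = 2 ^ (8 * j + 7) \<and> full_state (12 * j + 10) {4 * j + 4} (8 * j + 8) (4 * j + 4)"
    by (rule new_even[OF conjunct2[OF 9] _ _ _ b5]) auto
  have 11: "two_up (12 * j + 11) = 2 ^ (8 * j + 8) \<and> full_state (12 * j + 11) {4 * j + 4} (8 * j + 9) (4 * j + 4)"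
    by (rule new_odd[OF conjunct2[OF 10]]) auto
  have 12: "two_up (12 * j + 12) = 2 ^ (8 * j + 9) \<and>
      full_state (12 * j + 12) {4 * j + 4, 4 * j + 5} (8 * j + 10) (4 * j + 4)"
    by (rule new_even[OF conjunct2[OF 11] _ _ _ b6]) auto
  show "exc_half (2 * j + 1) q (2 * j + 1) c"
    unfolding exc_half_def double_index using 7 8 9 10 11 12 by simp
  \<comment> \<open>The bound reached is \<open>4 * j + 4\<close>; it is weakened to the common form
    at the start of a block.\<close>
  show "full_state (12 * Suc j) {4 * Suc j, 4 * Suc j + 1} (8 * Suc j + 2) (4 * Suc j + 1)"
    using 12 pairs_below_mono[of "12 * j + 12" "4 * j + 4" "4 * j + 5"] by (simp add: algebra_simps full_state_def)
  have e: "\<not> atom_end (12 * j + 6)" "\<not> atom_end (12 * j + 7)" "atom_end (12 * j + 8)"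
    "\<not> atom_end (12 * j + 9)" "\<not> atom_end (12 * j + 10)" "\<not> atom_end (12 * j + 11)"
    using not_atom_end_card[OF conjunct2[OF 6]] not_atom_end_card[OF conjunct2[OF 7]]
      atom_end_fresh[OF conjunct2[OF 8]] not_atom_end_card[OF conjunct2[OF 9]]
      not_atom_end_card[OF conjunct2[OF 10]] not_atom_end_card[OF conjunct2[OF 11]] pqc by auto
  have "{12 * j<..<12 * j + 12} = {12 * j + 1..12 * j + 5} \<union>
      {12 * j + 6, 12 * j + 7, 12 * j + 8, 12 * j + 9, 12 * j + 10, 12 * j + 11}"
    by auto
  with e start(7) pqc show "\<forall>n\<in>{12 * j<..<12 * j + 12}. atom_end n \<longleftrightarrow> n = 12 * j + 8"
    by auto
  show "two_up (12 * j + 1) = pair C (4 * j + 1)"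
    by (rule start(1)) (use pqc in simp)
  show "two_up (12 * j + 5) = pair p (4 * j + 2)"
    by (rule start(5)) (use pqc in simp)
qed

section \<open>The first 96 terms\<close>

fun subsets_desc :: "nat list \<Rightarrow> nat list list" where
  "subsets_desc [] = [[]]"
| "subsets_desc (r # F) = subsets_desc F @ map ((#) r) (subsets_desc F)"

type_synonym sim_state = "nat list list \<times> nat list \<times> nat \<times> nat list"

fun sim :: "nat \<Rightarrow> sim_state" where
  "sim 0 = ([[]], [], 0, [])"
| "sim (Suc n) = (case sim n of (as, F, N, es) \<Rightarrow>
     let A = (case filter (\<lambda>B. B \<notin> set as) (subsets_desc F) of [] \<Rightarrow> [N] | B # _ \<Rightarrow> B);
         as' = as @ [A];
         F' = filter (\<lambda>e. e \<notin> set A) F;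
         F'' = (if even (Suc n) then rev (sort (remdups (F' @ as' ! (Suc n div 2)))) else F')
     in (as', F'', if A = [N] then Suc N else N,
         if length F'' = 2 \<and> F'' \<notin> set as' then es @ [Suc n] else es))"

abbreviation desc :: "nat list \<Rightarrow> bool" where
  "desc \<equiv> sorted_wrt (>)"

abbreviation enc :: "nat list \<Rightarrow> nat" where
  "enc A \<equiv> set_encode (set A)"

lemma desc_eqI: "desc A \<Longrightarrow> desc B \<Longrightarrow> set A = set B \<Longrightarrow> A = B"
  using strict_sorted_equal[of "rev A" "rev B"] by (simp add: sorted_wrt_rev)

lemma desc_distinct: "desc A \<Longrightarrow> distinct A"
  by (induction A) auto

lemma set_subsets_desc: "set ` set (subsets_desc F) = Pow (set F)"
proof (induction F)
  case (Cons r F)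
  have "set ` (#) r ` X = insert r ` set ` X" for X
    by (simp add: image_image)
  then show ?case
    by (simp add: image_Un Pow_insert Cons)
qed simp

lemma desc_subsets_desc: "desc F \<Longrightarrow> B \<in> set (subsets_desc F) \<Longrightarrow> desc B"
proof (induction F arbitrary: B)
  case (Cons r F)
  consider "B \<in> set (subsets_desc F)" | C where "C \<in> set (subsets_desc F)" "B = r # C"
    using Cons.prems(2) by auto
  then show ?case
  proof cases
    case 2
    then have "set C \<subseteq> set F"
      using set_subsets_desc[of F] by blast
    then show ?thesis
      using 2 Cons by auto
  qed (use Cons in auto)
qed simp

lemma sorted_subsets_desc: "desc F \<Longrightarrow> sorted_wrt (\<lambda>A B. enc A < enc B) (subsets_desc F)"
proof (induction F)
  case (Cons r F)
  have sub: "set C \<subseteq> {..<r}" if "C \<in> set (subsets_desc F)" for C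
  proof -
    have "set C \<subseteq> set F"
      using that set_subsets_desc[of F] by blast
    then show ?thesis
      using Cons.prems by auto
  qed
  have enc: "enc (r # C) = 2 ^ r + enc C" "enc C < 2 ^ r" if "C \<in> set (subsets_desc F)" for C
  proof -
    have "r \<notin> set C"
      using sub[OF that] by auto
    then show "enc (r # C) = 2 ^ r + enc C"
      by (simp add: set_encode_insert)
    show "enc C < 2 ^ r"
      using sub[OF that] by (intro set_encode_less_power) auto
  qed
  have "sorted_wrt (\<lambda>A B. enc A < enc B) (map ((#) r) (subsets_desc F))"
    unfolding sorted_wrt_map using Cons
    by (auto intro!: sorted_wrt_mono_rel[of "subsets_desc F" "\<lambda>A B. enc A < enc B"] simp: enc(1) simp del: list.set)
  moreover have "enc A < enc B" if "A \<in> set (subsets_desc F)" "B \<in> (#) r ` set (subsets_desc F)" for A B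
    using enc(2)[OF that(1)] that(2) by (auto simp: enc(1) simp del: list.set)
  ultimately show ?case
    using Cons by (simp add: sorted_wrt_append)
qed simp

definition sim_ok :: "nat \<Rightarrow> sim_state \<Rightarrow> bool" where
  "sim_ok n s \<longleftrightarrow> (case s of (as, F, N, es) \<Rightarrow>
     length as = Suc n \<and> (\<forall>i\<le>n. desc (as ! i) \<and> two_up i = enc (as ! i)) \<and>
     desc F \<and> state n (set F) N \<and> set es = {m. m \<le> n \<and> atom_end m})"

lemma mem_iff_used:
  assumes "length as = Suc n" "\<forall>i\<le>n. desc (as ! i) \<and> two_up i = enc (as ! i)" "desc B"
  shows "B \<in> set as \<longleftrightarrow> enc B \<in> used n"
proof
  assume "enc B \<in> used n"
  then obtain i where i: "i \<le> n" "enc B = enc (as ! i)"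
    using assms(2) by auto
  then have "set B = set (as ! i)"
    by (metis List.finite_set set_encode_inverse)
  then have "B = as ! i"
    using assms i by (intro desc_eqI) auto
  then show "B \<in> set as"
    using assms(1) i by simp
qed (use assms in \<open>auto simp: in_set_conv_nth less_Suc_eq_le\<close>)

lemma sim_ok: "sim_ok n (sim n)"
proof (induction n)
  case 0
  then show ?case
    using atom_end_state[OF state_0] by (simp add: sim_ok_def state_0 two_up_0 cong: conj_cong)
next
  case (Suc n)
  obtain as F N es where sim: "sim n = (as, F, N, es)"
    by (cases "sim n") auto
  have as: "length as = Suc n" "\<forall>i\<le>n. desc (as ! i) \<and> two_up i = enc (as ! i)"
    and F: "desc F" and st: "state n (set F) N" and es: "set es = {m. m \<le> n \<and> atom_end m}"
    using Suc by (auto simp: sim sim_ok_def)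
  define A where "A = (case filter (\<lambda>B. B \<notin> set as) (subsets_desc F) of [] \<Rightarrow> [N] | B # _ \<Rightarrow> B)"
  define as' where "as' = as @ [A]"
  define F' where "F' = filter (\<lambda>e. e \<notin> set A) F"
  define F'' where "F'' = (if even (Suc n) then rev (sort (remdups (F' @ as' ! (Suc n div 2)))) else F')"
  define N' where "N' = (if A = [N] then Suc N else N)"
  define es' where "es' = (if length F'' = 2 \<and> F'' \<notin> set as' then es @ [Suc n] else es)"
  have sim': "sim (Suc n) = (as', F'', N', es')"
    by (simp add: sim Let_def A_def as'_def F'_def F''_def N'_def es'_def)
  have mem: "B \<in> set as \<longleftrightarrow> enc B \<in> used n" if "B \<in> set (subsets_desc F)" for B
    using mem_iff_used[OF as desc_subsets_desc[OF F that]] .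
  have A: "desc A \<and> two_up (Suc n) = enc A \<and> state (Suc n) (set F - set A \<union> freed (Suc n)) N'"
  proof (cases "filter (\<lambda>B. B \<notin> set as) (subsets_desc F)")
    case Nil
    then have "set_encode B \<in> used n" if "B \<subseteq> set F" for B
      using that mem set_subsets_desc[of F] unfolding filter_empty_conv by (metis PowI imageE)
    note * = state_new[OF st this]
    moreover have "set F - {N} = set F"
      using st by (auto simp: state_def)
    ultimately show ?thesis
      using Nil by (simp add: A_def N'_def set_encode_singleton)
  next
    case (Cons B Bs)
    have "B \<in> set (filter (\<lambda>B. B \<notin> set as) (subsets_desc F))"
      unfolding Cons by simp
    then have B: "B \<in> set (subsets_desc F)" "B \<notin> set as"
      by auto
    then have BF: "set B \<subseteq> set F" "enc B \<notin> used n"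
      using set_subsets_desc[of F] mem by blast+
    have "sorted_wrt (\<lambda>A B. enc A < enc B) (B # Bs)"
      unfolding Cons[symmetric] using sorted_subsets_desc[OF F] by (rule sorted_wrt_filter)
    then have less: "\<forall>C\<in>set Bs. enc B < enc C"
      by simp
    have all: "set_encode C \<in> used n" if "C \<subseteq> set F" "set_encode C < enc B" for C
    proof (rule ccontr)
      assume C: "set_encode C \<notin> used n"
      obtain D where D: "D \<in> set (subsets_desc F)" "C = set D"
        using \<open>C \<subseteq> set F\<close> set_subsets_desc[of F] by (metis PowI imageE)
      then have "D \<in> set (filter (\<lambda>B. B \<notin> set as) (subsets_desc F))"
        using C mem by auto
      then show False
        unfolding Cons using less that D by auto
    qed
    have "B \<noteq> [N]"
      using BF st by (auto simp: state_def)
    then show ?thesis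
      using state_old[OF st BF all] desc_subsets_desc[OF F B(1)] Cons by (simp add: A_def N'_def)
  qed
  have as': "length as' = Suc (Suc n)" "\<forall>i\<le>Suc n. desc (as' ! i) \<and> two_up i = enc (as' ! i)"
    using as A by (auto simp: as'_def nth_append less_Suc_eq le_Suc_eq)
  have F': "desc F'"
    using F unfolding F'_def by (rule sorted_wrt_filter)
  have "sorted_wrt (<) (sort (remdups xs))" for xs :: "nat list"
    by (simp add: strict_sorted_iff)
  then have F'': "desc F''"
    using F' by (simp add: F''_def sorted_wrt_rev)
  have "freed (Suc n) = (if even (Suc n) then set (as' ! (Suc n div 2)) else {})"
    using as'(2) by (auto simp: freed_def bit_set_encode)
  then have set_F'': "set F'' = set F - set A \<union> freed (Suc n)"
    by (auto simp: F''_def F'_def)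
  have st': "state (Suc n) (set F'') N'"
    using A set_F'' by simp
  have "atom_end (Suc n) \<longleftrightarrow> length F'' = 2 \<and> F'' \<notin> set as'"
    unfolding atom_end_state[OF st'] mem_iff_used[OF as' F''] distinct_card[OF desc_distinct[OF F'']] ..
  then have "set es' = {m. m \<le> Suc n \<and> atom_end m}"
    using es by (auto simp: es'_def le_Suc_eq)
  then show ?case
    using as' F'' st' unfolding sim' sim_ok_def by simp
qed

section \<open>The table of terms 0 to 96 and facts read off from it\<close>

definition base_terms :: "nat list list" where
  "base_terms =
    [[], [0], [1], [2], [3], [1, 0], [4], [5], [6], [3, 2], [7], [8], [9], [4, 0], [10], [5, 1],
    [11], [12], [13], [6, 2], [14], [7, 3], [15], [16], [17], [9, 8], [18], [19], [20], [10, 0],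
    [21], [4, 1], [22], [11, 5], [23], [24], [25], [13, 12], [26], [27], [28], [14, 2], [29],
    [6, 3], [30], [15, 7], [31], [32], [33], [17, 16], [34], [35], [36], [18, 8], [37], [19, 9],
    [38], [39], [40], [20, 0], [41], [21, 10], [42], [43], [44], [22, 1], [45], [5, 4], [46],
    [23, 11], [47], [48], [49], [25, 24], [50], [51], [52], [26, 12], [53], [27, 13], [54], [55],
    [56], [28, 2], [57], [29, 14], [58], [59], [60], [30, 3], [61], [7, 6], [62], [31, 15], [63],
    [64], [65]]"

definition base_ends :: "nat list" where
  "base_ends = [4, 8, 14, 20, 24, 32, 36, 44, 48, 54, 60, 68, 72, 78, 84, 92, 96]"

lemma sim_96: "sim 96 = (base_terms, [33, 32], 66, base_ends)"
  by code_simp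

lemma base_two_up: "i \<le> 96 \<Longrightarrow> two_up i = enc (base_terms ! i)"
  using sim_ok[of 96] unfolding sim_96 sim_ok_def by simp

lemma base_desc: "i \<le> 96 \<Longrightarrow> desc (base_terms ! i)"
  using sim_ok[of 96] unfolding sim_96 sim_ok_def by simp

lemma base_atom_end: "n \<le> 96 \<Longrightarrow> atom_end n \<longleftrightarrow> n \<in> set base_ends"
  using sim_ok[of 96] unfolding sim_96 sim_ok_def by auto

lemma length_base_terms: "length base_terms = 97"
  using sim_ok[of 96] unfolding sim_96 sim_ok_def by simp

lemma enc_pair: "u < v \<Longrightarrow> enc [v, u] = pair u v"
  by (simp add: pair_conv_set_encode insert_commute)

lemma enc_single: "enc [u] = 2 ^ u"
  by (simp add: set_encode_singleton)

lemma weight_base: "i \<le> 96 \<Longrightarrow> weight (two_up i) = length (base_terms ! i)"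
  by (simp add: base_two_up weight_def bit_set_encode distinct_card desc_distinct base_desc)

lemma base_pairs_below:
  assumes "n \<le> 96" "\<forall>A\<in>set (take (Suc n) base_terms). (\<forall>e\<in>set A. e < T) \<or> length A = 1"
  shows "pairs_below n T"
  unfolding pairs_below_def
proof
  fix m assume "m \<in> used n"
  then obtain i where i: "i \<le> n" "m = two_up i"
    by auto
  then have "base_terms ! i \<in> set (take (Suc n) base_terms)"
    using assms(1) length_base_terms by (auto simp: in_set_conv_nth intro!: exI[of _ i])
  then consider "\<forall>e\<in>set (base_terms ! i). e < T" | "length (base_terms ! i) = 1"
    using assms(2) by blast
  then show "m < 2 ^ T \<or> (\<exists>e. m = 2 ^ e)"
  proof cases
    case 1
    then show ?thesis
      using i assms(1) by (intro disjI1) (auto simp: base_two_up intro!: set_encode_less_power)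
  next
    case 2
    then obtain e where "base_terms ! i = [e]"
      by (auto simp: length_Suc_conv)
    then show ?thesis
      using i assms(1) by (auto simp: base_two_up set_encode_singleton)
  qed
qed

text \<open>This excludes the first 48 terms when a pair with larger exponent
  \<open>2 * j + 1\<close> is to be new: for \<open>j \<ge> 8\<close> that exponent is at least
  17.\<close>

lemma pairs_below_48: "pairs_below 48 17"
  by (rule base_pairs_below) (simp_all add: base_terms_def)

lemma pairs_below_96: "pairs_below 96 33"
  by (rule base_pairs_below) (simp_all add: base_terms_def)

lemma full_state_96: "full_state 96 {32, 33} 66 33"
  using sim_ok[of 96] pairs_below_96 unfolding sim_96 sim_ok_def by (simp add: full_state_def insert_commute)

section \<open>The pattern of blocks\<close>

definition mu_values :: "nat set" where
  "mu_values = {v. (\<exists>i. v = 2 ^ i) \<or> (\<exists>i. v = 3 * 2 ^ i)}"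

lemma mu_values_double: "2 * m \<in> mu_values \<longleftrightarrow> m \<in> mu_values"
proof
  assume "2 * m \<in> mu_values"
  then consider i where "2 * m = 2 ^ i" | i where "2 * m = 3 * 2 ^ i"
    by (auto simp: mu_values_def)
  then show "m \<in> mu_values"
  proof cases
    case 1
    then show ?thesis
      by (cases i) (auto simp: mu_values_def)
  next
    case 2
    then show ?thesis
      by (cases i) (auto simp: mu_values_def, presburger)
  qed
next
  assume "m \<in> mu_values"
  then show "2 * m \<in> mu_values"
    unfolding mu_values_def by (auto simp: mult.left_commute simp flip: power_Suc)
qed

lemma mu_values_odd: "m \<in> mu_values \<Longrightarrow> odd m \<Longrightarrow> m = 1 \<or> m = 3"
  by (auto simp: mu_values_def)

lemma one_mem_mu_values: "1 \<in> mu_values" "Suc 0 \<in> mu_values"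
  by (auto simp: mu_values_def intro!: exI[of _ 0])

lemma three_mem_mu_values: "3 \<in> mu_values"
  unfolding mu_values_def by (auto intro!: exI[of _ 0])

text \<open>Halving recursion by which the simplifier decides membership of numerals.\<close>

lemma mem_mu_values_rec: "m \<in> mu_values \<longleftrightarrow> m = 1 \<or> m = 3 \<or> even m \<and> m div 2 \<in> mu_values"
  using mu_values_double[of "m div 2"] mu_values_odd[of m] one_mem_mu_values three_mem_mu_values
  by (cases "even m") auto

lemmas numeral_mem_mu_values = mem_mu_values_rec[of "numeral k" for k]

lemmas mem_mu_values = numeral_mem_mu_values one_mem_mu_values

text \<open>An even \<open>j\<close> would make \<open>Suc j\<close> an odd value other than 1 and
  3. The cases 11 and 15 are where the two chains \<open>j \<mapsto> 2 * j + 1\<close> of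
  exceptional halves, with \<open>Suc j\<close> of the form \<open>3 * 2 ^ i\<close> or
  \<open>2 ^ i\<close>, enter the range \<open>j \<ge> 8\<close>.\<close>

lemma mu_values_cases:
  assumes "Suc j \<in> mu_values" "8 \<le> j"
  obtains "j = 11" | "j = 15" | "23 \<le> j" "odd j" "Suc (j div 2) \<in> mu_values"
proof -
  have odd: "odd j"
    using mu_values_odd[OF assms(1)] assms(2) by auto
  then obtain t where t: "j = 2 * t + 1"
    by (auto elim: oddE)
  have "2 * Suc t \<in> mu_values"
    using assms(1) t by simp
  then have mem: "Suc t \<in> mu_values"
    using mu_values_double by blast
  have "j = 11 \<or> j = 15 \<or> 23 \<le> j"
  proof (rule ccontr)
    assume *: "\<not> ?thesis"
    then have "t = 4 \<or> t = 6 \<or> t = 8 \<or> t = 9 \<or> t = 10"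
      using t assms(2) by presburger
    then show False
      using mem by (auto simp: mem_mu_values)
  qed
  then show thesis
    using that odd mem t by auto
qed

text \<open>The parameter \<open>c\<close> of the exceptional halves, constant along each of the two
  chains; divisibility by 3 tells them apart. It becomes the exponent \<open>s\<close> of the
  theorem.\<close>

definition core :: "nat \<Rightarrow> nat" where
  "core i = (if 3 dvd Suc i then 11 else 15)"

text \<open>The values below 16 make the description of exceptional halves uniform: the pattern of the
  exceptional pairs becomes regular only from block 23 on.\<close>

definition lead :: "nat \<Rightarrow> nat" where
  "lead i = (if i < 8 then i - 1 else if i < 16 then i div 2 else i)"

definition half :: "nat \<Rightarrow> bool" where
  "half i \<longleftrightarrow> (if Suc i \<in> mu_values then exc_half i (lead (i div 2)) (lead i) (core i) else reg_half i)"

text \<open>The smaller exponent free at the start of block \<open>j\<close>: an exceptional block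
  \<open>j - 1\<close> leaves \<open>4 * j\<close>, a regular one \<open>2 * j\<close>.\<close>

definition carry :: "nat \<Rightarrow> nat" where
  "carry j = (if j \<in> mu_values then 4 * j else 2 * j)"

lemma lead_le: "lead i \<le> i"
  by (simp add: lead_def)

lemma core_double: "core (2 * j + 1) = core j"
proof -
  have "3 dvd Suc (2 * j + 1) \<longleftrightarrow> 3 dvd Suc j"
    by presburger
  then show ?thesis
    by (simp add: core_def)
qed

text \<open>Side conditions for \<open>exceptional_block\<close>. From 23 on,
  \<open>lead j = j\<close> exceeds \<open>core j\<close>, which is at most 15. For 11 and 15 the
  order is reversed: 5 against 11 and 7 against 15.\<close>

lemma lead_core:
  assumes "Suc j \<in> mu_values" "8 \<le> j"
  shows "lead (j div 2) < lead j" "core j < 2 * j + 1" "lead j \<noteq> core j"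
proof -
  have "lead (j div 2) < lead j \<and> core j < 2 * j + 1 \<and> lead j \<noteq> core j"
  proof (cases rule: mu_values_cases[OF assms])
    case 3
    have "core j \<le> 15"
      by (simp add: core_def)
    moreover have "lead j = j"
      using 3 by (simp add: lead_def)
    moreover have "j div 2 < j"
      using 3 by simp
    ultimately show ?thesis
      using 3 lead_le[of "j div 2"] by linarith
  qed (simp_all add: lead_def core_def)
  then show "lead (j div 2) < lead j" "core j < 2 * j + 1" "lead j \<noteq> core j"
    by auto
qed

lemma base_half:
  assumes "8 \<le> i" "i < 16"
  shows "half i"
proof -
  have regI: "reg_half i"
    if "p < 2 * i + 1" "p' < 2 * i + 2"
      and "map two_up [6 * i + 1, 6 * i + 2, 6 * i + 3, 6 * i + 4, 6 * i + 5, 6 * i + 6] =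
        map enc [[2 * i + 1, p], [4 * i + 2], [4 * i + 3], [4 * i + 4], [2 * i + 2, p'], [4 * i + 5]]"
    for i p p'
    unfolding reg_half_def
    by (rule exI[of _ p], rule exI[of _ p'])
      (use that enc_pair[OF that(1)] enc_pair[OF that(2)] in \<open>simp add: enc_single del: list.set\<close>)
  have "reg_half 8"
    by (rule regI[where p = 16 and p' = 8]) (simp_all add: base_two_up base_terms_def)
  moreover have "reg_half 9"
    by (rule regI[where p = 9 and p' = 0]) (simp_all add: base_two_up base_terms_def)
  moreover have "reg_half 10"
    by (rule regI[where p = 10 and p' = 1]) (simp_all add: base_two_up base_terms_def)
  moreover have "reg_half 12"
    by (rule regI[where p = 24 and p' = 12]) (simp_all add: base_two_up base_terms_def)
  moreover have "reg_half 13"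
    by (rule regI[where p = 13 and p' = 2]) (simp_all add: base_two_up base_terms_def)
  moreover have "reg_half 14"
    by (rule regI[where p = 14 and p' = 3]) (simp_all add: base_two_up base_terms_def)
  moreover have "exc_half 11 4 5 11" "exc_half 15 6 7 15"
    unfolding exc_half_def
    by (simp_all add: base_two_up base_terms_def pair_conv_set_encode set_encode_singleton insert_commute)
  moreover have "i \<in> {8, 9, 10, 11, 12, 13, 14, 15}"
    using assms by auto
  ultimately show ?thesis
    by (auto simp: half_def lead_def core_def mem_mu_values)
qed

section \<open>The induction over blocks\<close>

lemma exceptional_step:
  assumes st: "full_state (12 * j) {carry j, 4 * j + 1} (8 * j + 2) (4 * j + 1)"
    and halves: "\<forall>i\<in>{8..<2 * j}. half i" and j: "8 \<le> j" "Suc j \<in> mu_values"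
  shows "two_up (12 * j + 1) = pair (2 * j) (4 * j + 1)" "two_up (12 * j + 5) = pair (lead (j div 2)) (4 * j + 2)"
    "reg_half (2 * j)" "exc_half (2 * j + 1) (lead j) (2 * j + 1) (core j)"
    "full_state (12 * Suc j) {4 * Suc j, 4 * Suc j + 1} (8 * Suc j + 2) (4 * Suc j + 1)"
    "\<forall>n\<in>{12 * j<..<12 * j + 12}. atom_end n \<longleftrightarrow> n = 12 * j + 8"
proof -
  \<comment> \<open>An odd \<open>j \<ge> 8\<close> is not a value of \<open>mu\<close>, so the
    preceding block is regular.\<close>
  have "odd j"
    using mu_values_odd[OF j(2)] j(1) by auto
  then have carry: "carry j = 2 * j"
    using mu_values_odd[of j] j(1) by (auto simp: carry_def)
  have exc: "exc_half j (lead (j div 2)) (lead j) (core j)"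
    using halves j by (auto simp: half_def dest: bspec[of _ _ j])
  \<comment> \<open>This pair is the third term of the exceptional half \<open>j div 2\<close>. For
    \<open>j = 11\<close> and \<open>j = 15\<close> that half is 5 or 7, outside the range covered
    by \<open>half\<close>, and the table supplies its third term, with index 33 or 45.\<close>
  have used: "pair (lead j) (core j) \<in> used (12 * j)"
  proof (cases rule: mu_values_cases[OF j(2,1)])
    case 1
    have "two_up 33 = pair 5 11"
      by (simp add: base_two_up base_terms_def pair_conv_set_encode insert_commute)
    then show ?thesis
      using 1 by (intro usedI[of 33]) (auto simp: lead_def core_def)
  next
    case 2
    have "two_up 45 = pair 7 15"
      by (simp add: base_two_up base_terms_def pair_conv_set_encode insert_commute)
    then show ?thesis
      using 2 by (intro usedI[of 45]) (auto simp: lead_def core_def)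
  next
    case 3
    define t where "t = j div 2"
    have t: "j = 2 * t + 1"
      using 3(2) by (simp add: t_def)
    have "half t"
      using halves 3 t by auto
    then have "two_up (6 * t + 3) = pair (core t) (2 * t + 1)"
      using 3(3) by (simp add: half_def exc_half_def t_def)
    then have "two_up (6 * t + 3) = pair (lead j) (core j)"
      using 3(1) core_double[of t] by (simp add: t lead_def pair_commute)
    then show ?thesis
      by (rule usedI) (simp add: t)
  qed
  \<comment> \<open>Pairs up to index 48 are too small, and later terms lie in halves
    \<open>i\<close> with \<open>8 \<le> i \<le> 2 * j\<close>. The larger exponent
    \<open>2 * j + 1\<close> can occur only for \<open>i = j\<close>. The pair there joins it to
    \<open>core j\<close>, which differs from \<open>lead j\<close>.\<close>
  have unused: "pair (lead j) (2 * j + 1) \<notin> used (12 * j + 6)" if reg: "reg_half (2 * j)"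
  proof
    assume "pair (lead j) (2 * j + 1) \<in> used (12 * j + 6)"
    then obtain n where n: "n \<le> 12 * j + 6" "two_up n = pair (lead j) (2 * j + 1)"
      by auto
    have less: "lead j < 2 * j + 1"
      using lead_le[of j] by simp
    have "\<not> n \<le> 48"
    proof
      assume "n \<le> 48"
      then have "pair (lead j) (2 * j + 1) \<in> used 48"
        using n by (intro usedI)
      then show False
        using pairs_below_fresh[OF pairs_below_48 _ less] j by simp
    qed
    define i where "i = (n - 1) div 6"
    define t where "t = (n - 1) mod 6"
    have "6 * i + t = n - 1" "t < 6"
      by (simp_all add: i_def t_def)
    then have nt: "n = 6 * i + (t + 1)" "t < 6"
      using \<open>\<not> n \<le> 48\<close> by linarith+
    then have i: "8 \<le> i" "i \<le> 2 * j"
      using \<open>\<not> n \<le> 48\<close> n(1) by linarith+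
    have "t \<in> {0, 1, 2, 3, 4, 5}"
      using nt(2) by auto
    then have n_cases: "n \<in> {6 * i + 1, 6 * i + 2, 6 * i + 3, 6 * i + 4, 6 * i + 5, 6 * i + 6}"
      unfolding nt(1) by auto
    \<comment> \<open>Half \<open>2 * j\<close> is regular in any case, so \<open>reg\<close>
      completes the knowledge of all halves up to it.\<close>
    have "odd (2 * j + 1)"
      by simp
    then have "2 * j + 1 \<notin> mu_values"
      using mu_values_odd j by fastforce
    then have "half i"
      using reg halves i by (cases "i = 2 * j") (auto simp: half_def)
    have no_power: "two_up n \<noteq> 2 ^ e" for e
      unfolding n(2) using less by (intro pair_neq_power) auto
    have pairs: "u = lead j \<and> v = 2 * j + 1" if "two_up n = pair u v" "u < v" for u v
      using that n(2) less pair_eq_iff[of "lead j" "2 * j + 1" u v] by simp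
    show False
    proof (cases "Suc i \<in> mu_values")
      case True
      then have "exc_half i (lead (i div 2)) (lead i) (core i)"
        using \<open>half i\<close> by (simp add: half_def)
      then have "(\<exists>e. two_up n = 2 ^ e) \<or> two_up n = pair (lead (i div 2)) (lead i) \<or>
          two_up n = pair (core i) (2 * i + 1)"
        using n_cases unfolding exc_half_def by (elim insertE emptyE; hypsubst; blast)
      then have "two_up n = pair (lead (i div 2)) (lead i) \<or> two_up n = pair (core i) (2 * i + 1)"
        using no_power by blast
      then show False
        using pairs[OF _ lead_core(1)[OF True i(1)]] pairs[OF _ lead_core(2)[OF True i(1)]]
          lead_core(3)[OF j(2,1)] lead_le[of i] i(2) by auto
    next
      case False
      then have "reg_half i"
        using \<open>half i\<close> by (simp add: half_def)
      then obtain p p' where p: "p < 2 * i + 1" "p' < 2 * i + 2"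
        and "two_up (6 * i + 1) = pair p (2 * i + 1) \<and> two_up (6 * i + 2) = 2 ^ (4 * i + 2) \<and>
          two_up (6 * i + 3) = 2 ^ (4 * i + 3) \<and> two_up (6 * i + 4) = 2 ^ (4 * i + 4) \<and>
          two_up (6 * i + 5) = pair p' (2 * i + 2) \<and> two_up (6 * i + 6) = 2 ^ (4 * i + 5)"
        unfolding reg_half_def by blast
      then have "(\<exists>e. two_up n = 2 ^ e) \<or> two_up n = pair p (2 * i + 1) \<or> two_up n = pair p' (2 * i + 2)"
        using n_cases by (elim insertE emptyE; hypsubst; blast)
      then have "two_up n = pair p (2 * i + 1) \<or> two_up n = pair p' (2 * i + 2)"
        using no_power by blast
      then have "2 * i + 1 = 2 * j + 1 \<or> 2 * i + 2 = 2 * j + 1"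
        using pairs p by blast
      then have "i = j"
        by presburger
      then show False
        using False j(2) by simp
    qed
  qed
  have "lead j < 2 * j + 1"
    using lead_le[of j] by simp
  note block = exceptional_block[OF st _ exc lead_core(1)[OF j(2,1)] this lead_core(2,3)[OF j(2,1)] used unused]
  show "two_up (12 * j + 1) = pair (2 * j) (4 * j + 1)"
    using block(1) by (simp add: carry)
  show "two_up (12 * j + 5) = pair (lead (j div 2)) (4 * j + 2)"
    using block(2) by (simp add: carry)
  show "reg_half (2 * j)" "exc_half (2 * j + 1) (lead j) (2 * j + 1) (core j)"
    using block(3,4) by (simp_all add: carry)
  show "full_state (12 * Suc j) {4 * Suc j, 4 * Suc j + 1} (8 * Suc j + 2) (4 * Suc j + 1)"
    using block(5) by (simp add: carry)
  show "\<forall>n\<in>{12 * j<..<12 * j + 12}. atom_end n \<longleftrightarrow> n = 12 * j + 8"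
    using block(6) by (simp add: carry)
qed

lemma regular_step:
  assumes st: "full_state (12 * j) {carry j, 4 * j + 1} (8 * j + 2) (4 * j + 1)"
    and halves: "\<forall>i\<in>{8..<2 * j}. half i" and j: "8 \<le> j" "Suc j \<notin> mu_values"
  shows "reg_half (2 * j)" "reg_half (2 * j + 1)"
    "full_state (12 * Suc j) {2 * Suc j, 4 * Suc j + 1} (8 * Suc j + 2) (4 * Suc j + 1)"
    "\<forall>n\<in>{12 * j<..<12 * j + 12}. atom_end n \<longleftrightarrow> n = 12 * j + 6"
proof -
  have "carry j < 4 * j + 1"
    by (simp add: carry_def)
  moreover have "reg_half j"
    using halves j by (auto simp: half_def dest: bspec[of _ _ j])
  ultimately show "reg_half (2 * j)" "reg_half (2 * j + 1)"
    "full_state (12 * Suc j) {2 * Suc j, 4 * Suc j + 1} (8 * Suc j + 2) (4 * Suc j + 1)"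
    "\<forall>n\<in>{12 * j<..<12 * j + 12}. atom_end n \<longleftrightarrow> n = 12 * j + 6"
    using regular_block[OF st] by blast+
qed

text \<open>Block \<open>j\<close> needs half \<open>j\<close>, which is among those known because
  \<open>j < 2 * j\<close>. Half \<open>2 * j\<close> is always regular, as \<open>2 * j + 1\<close>
  is odd and exceeds 3, while half \<open>2 * j + 1\<close> has the kind of half
  \<open>j\<close>.\<close>

lemma block_state:
  "8 \<le> j \<Longrightarrow> full_state (12 * j) {carry j, 4 * j + 1} (8 * j + 2) (4 * j + 1) \<and> (\<forall>i\<in>{8..<2 * j}. half i)"
proof (induction j rule: nat_induct_at_least)
  case base
  show ?case
    using full_state_96 base_half by (simp add: carry_def mem_mu_values)
next
  case (Suc j)
  then have st: "full_state (12 * j) {carry j, 4 * j + 1} (8 * j + 2) (4 * j + 1)"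
    and halves: "\<forall>i\<in>{8..<2 * j}. half i"
    by auto
  have odd: "Suc (2 * j) \<notin> mu_values"
    using mu_values_odd[of "Suc (2 * j)"] Suc.hyps by auto
  have double: "Suc (2 * j + 1) \<in> mu_values \<longleftrightarrow> Suc j \<in> mu_values"
    using mu_values_double[of "Suc j"] by simp
  have split: "{8..<2 * Suc j} = {8..<2 * j} \<union> {2 * j, 2 * j + 1}"
    using Suc.hyps by auto
  show ?case
  proof (cases "Suc j \<in> mu_values")
    case True
    note step = exceptional_step[OF st halves Suc.hyps True]
    have "lead (2 * j + 1) = 2 * j + 1"
      using Suc.hyps by (simp add: lead_def)
    then have "half (2 * j)" "half (2 * j + 1)"
      using step(3,4) odd double True by (simp_all add: half_def core_double[simplified])
    then show ?thesis
      using step(5) True halves unfolding split by (simp add: carry_def)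
  next
    case False
    note step = regular_step[OF st halves Suc.hyps False]
    have "half (2 * j)" "half (2 * j + 1)"
      using step(1,2) odd double False by (simp_all add: half_def)
    then show ?thesis
      using step(3) False halves unfolding split by (simp add: carry_def)
  qed
qed

section \<open>Atoms\<close>

lemma atom_end_multiple:
  assumes "2 \<le> j"
  shows "atom_end (12 * j)"
proof (cases "8 \<le> j")
  case True
  then have "full_state (12 * j) {carry j, 4 * j + 1} (8 * j + 2) (4 * j + 1)"
    using block_state by blast
  then show ?thesis
    by (rule atom_end_fresh) (simp_all add: carry_def)
next
  case False
  then have "j \<in> {2, 3, 4, 5, 6, 7}"
    using assms by auto
  then show ?thesis
    by (auto simp: base_atom_end base_ends_def)
qed

lemma atom_end_in_block:
  assumes "2 \<le> j"
  shows "\<forall>n\<in>{12 * j<..<12 * j + 12}. atom_end n \<longleftrightarrow> n = 12 * j + (if Suc j \<in> mu_values then 8 else 6)"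
proof (cases "8 \<le> j")
  case True
  then show ?thesis
    using block_state[OF True] exceptional_step(6)[of j] regular_step(4)[of j] by auto
next
  case False
  have "{12 * j<..<12 * j + 12} = {12 * j + 1..12 * j + 5} \<union> {12 * j + 6..12 * j + 11}"
    by auto
  also have "{12 * j + 1..12 * j + 5} = {12 * j + 1, 12 * j + 2, 12 * j + 3, 12 * j + 4, 12 * j + 5}"
    by auto
  also have "{12 * j + 6..12 * j + 11} =
      {12 * j + 6, 12 * j + 7, 12 * j + 8, 12 * j + 9, 12 * j + 10, 12 * j + 11}"
    by auto
  finally have "{12 * j<..<12 * j + 12} =
      {12 * j + 1, 12 * j + 2, 12 * j + 3, 12 * j + 4, 12 * j + 5} \<union>
      {12 * j + 6, 12 * j + 7, 12 * j + 8, 12 * j + 9, 12 * j + 10, 12 * j + 11}" .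
  moreover have "j \<in> {2, 3, 4, 5, 6, 7}"
    using False assms by auto
  ultimately show ?thesis
    by (auto simp: base_atom_end base_ends_def mem_mu_values)
qed

section \<open>Weights of terms, and the code of the first atom of an exceptional block\<close>

lemma half_weights:
  assumes "8 \<le> i" "half i"
  shows "weight (two_up (6 * i + 1)) = 2" "weight (two_up (6 * i + 2)) = 1"
    "weight (two_up (6 * i + 3)) = (if Suc i \<in> mu_values then 2 else 1)"
    "weight (two_up (6 * i + 4)) = 1"
    "weight (two_up (6 * i + 5)) = (if Suc i \<in> mu_values then 1 else 2)"
    "weight (two_up (6 * i + 6)) = 1"
proof -
  have "weight (two_up (6 * i + 1)) = 2 \<and> weight (two_up (6 * i + 2)) = 1 \<and>
    weight (two_up (6 * i + 3)) = (if Suc i \<in> mu_values then 2 else 1) \<and>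
    weight (two_up (6 * i + 4)) = 1 \<and>
    weight (two_up (6 * i + 5)) = (if Suc i \<in> mu_values then 1 else 2) \<and>
    weight (two_up (6 * i + 6)) = 1"
  proof (cases "Suc i \<in> mu_values")
    case True
    then have exc: "exc_half i (lead (i div 2)) (lead i) (core i)"
      using assms by (simp add: half_def)
    have "weight (pair (lead (i div 2)) (lead i)) = 2" "weight (pair (core i) (2 * i + 1)) = 2"
      using lead_core[OF True assms(1)] by (intro weight_pair; simp)+
    then show ?thesis
      using exc True unfolding exc_half_def by (simp only: weight_power if_True simp_thms)
  next
    case False
    then have "reg_half i"
      using assms by (simp add: half_def)
    then obtain p p' where p: "p < 2 * i + 1" "p' < 2 * i + 2"
      and reg: "two_up (6 * i + 1) = pair p (2 * i + 1) \<and> two_up (6 * i + 2) = 2 ^ (4 * i + 2) \<and>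
        two_up (6 * i + 3) = 2 ^ (4 * i + 3) \<and> two_up (6 * i + 4) = 2 ^ (4 * i + 4) \<and>
        two_up (6 * i + 5) = pair p' (2 * i + 2) \<and> two_up (6 * i + 6) = 2 ^ (4 * i + 5)"
      unfolding reg_half_def by blast
    have "weight (pair p (2 * i + 1)) = 2" "weight (pair p' (2 * i + 2)) = 2"
      using p by (intro weight_pair; simp)+
    then show ?thesis
      using reg False by (simp only: weight_power if_False simp_thms)
  qed
  then show "weight (two_up (6 * i + 1)) = 2" "weight (two_up (6 * i + 2)) = 1"
    "weight (two_up (6 * i + 3)) = (if Suc i \<in> mu_values then 2 else 1)"
    "weight (two_up (6 * i + 4)) = 1"
    "weight (two_up (6 * i + 5)) = (if Suc i \<in> mu_values then 1 else 2)"
    "weight (two_up (6 * i + 6)) = 1"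
    by blast+
qed

text \<open>The first list concerns the terms of the atom, the second the terms freed at its four
  even indices.\<close>

lemma exceptional_weights:
  assumes "2 \<le> j" "Suc j \<in> mu_values"
  shows "map (\<lambda>r. weight (two_up (12 * j + r))) [1, 2, 3, 4, 5, 6, 7, 8] = [2, 1, 1, 1, 2, 1, 2, 1]"
    "map (\<lambda>r. weight (two_up (6 * j + r))) [1, 2, 3, 4] = [2, 1, 2, 1]"
proof -
  have "map (\<lambda>r. weight (two_up (12 * j + r))) [1, 2, 3, 4, 5, 6, 7, 8] = [2, 1, 1, 1, 2, 1, 2, 1] \<and>
    map (\<lambda>r. weight (two_up (6 * j + r))) [1, 2, 3, 4] = [2, 1, 2, 1]"
  proof (cases "8 \<le> j")
    case True
    have half: "half i" if "8 \<le> i" "i < 2 * Suc j" for i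
      using block_state[of "Suc j"] True that by auto
    have "Suc (2 * j) \<notin> mu_values"
      using mu_values_odd[of "Suc (2 * j)"] True by auto
    moreover have "8 \<le> 2 * j"
      using True by simp
    moreover have "6 * (2 * j) + r = 12 * j + r" for r
      by simp
    ultimately have even: "weight (two_up (12 * j + 1)) = 2" "weight (two_up (12 * j + 2)) = 1"
      "weight (two_up (12 * j + 3)) = 1" "weight (two_up (12 * j + 4)) = 1"
      "weight (two_up (12 * j + 5)) = 2" "weight (two_up (12 * j + 6)) = 1"
      using half_weights[OF _ half, of "2 * j"] by (simp_all only: if_False) simp_all
    have index: "6 * (2 * j + 1) + 1 = 12 * j + 7" "6 * (2 * j + 1) + 2 = 12 * j + 8"
      by simp_all
    have "8 \<le> 2 * j + 1" "half (2 * j + 1)"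
      using True half by simp_all
    from half_weights(1,2)[OF this] have odd: "weight (two_up (12 * j + 7)) = 2" "weight (two_up (12 * j + 8)) = 1"
      by (simp_all only: index)
    show ?thesis
      using even odd half_weights[OF True half] assms True by simp
  next
    case False
    then have "j \<in> {2, 3, 4, 5, 6, 7}"
      using assms by auto
    then show ?thesis
      using assms(2) by (elim insertE emptyE) (simp_all add: weight_base base_terms_def mem_mu_values)
  qed
  then show "map (\<lambda>r. weight (two_up (12 * j + r))) [1, 2, 3, 4, 5, 6, 7, 8] = [2, 1, 1, 1, 2, 1, 2, 1]"
    "map (\<lambda>r. weight (two_up (6 * j + r))) [1, 2, 3, 4] = [2, 1, 2, 1]"
    by blast+
qed

lemma exceptional_code:
  assumes "2 \<le> j" "Suc j \<in> mu_values"
  shows "atom_code (12 * j + 1) (12 * j + 8) =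
       [Allocated 2, Allocated 1, Freed 2, Allocated 1, Allocated 1, Freed 1,
        Allocated 2, Allocated 1, Freed 2, Allocated 2, Allocated 1, Freed 1]"
proof -
  have "[12 * j + 1..<Suc (12 * j + 8)] = map (\<lambda>r. r + (12 * j + 1)) [0..<8]"
    unfolding map_add_upt by simp
  also have "\<dots> = [12 * j + 1, 12 * j + 2, 12 * j + 3, 12 * j + 4, 12 * j + 5, 12 * j + 6, 12 * j + 7, 12 * j + 8]"
    by (simp add: upt_rec)
  finally have upt: "[12 * j + 1..<Suc (12 * j + 8)] =
    [12 * j + 1, 12 * j + 2, 12 * j + 3, 12 * j + 4, 12 * j + 5, 12 * j + 6, 12 * j + 7, 12 * j + 8]" .
  have "(12 * j + 2) div 2 = 6 * j + 1" "(12 * j + 4) div 2 = 6 * j + 2"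
    "(12 * j + 6) div 2 = 6 * j + 3" "(12 * j + 8) div 2 = 6 * j + 4"
    by simp_all
  then show ?thesis
    using exceptional_weights[OF assms] unfolding atom_code_def upt by simp
qed

text \<open>An atom has as many terms as its code has letters A, so type X forces eight
  terms.\<close>

lemma count_Allocated:
  "length (filter (\<lambda>l. \<exists>w. l = Allocated w) (atom_code m n)) = Suc n - m"
proof -
  have "length (filter (\<lambda>l. \<exists>w. l = Allocated w) (concat (map (\<lambda>i. Allocated (weight (two_up i)) #
      (if even i then [Freed (weight (two_up (i div 2)))] else [])) xs))) = length xs" for xs
    by (induction xs) auto
  then show ?thesis
    unfolding atom_code_def by (simp del: upt_Suc)
qed

text \<open>From block 2 on, an exceptional block splits into atoms of 8 and 4 terms, a regular one
  into 6 and 6, and no earlier atom has eight terms. So length alone singles out the first atoms of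
  exceptional blocks.\<close>

lemma is_X_atom_iff:
  "is_X_atom m n \<longleftrightarrow> (\<exists>j\<ge>2. Suc j \<in> mu_values \<and> m = 12 * j + 1 \<and> n = 12 * j + 8)"
proof
  assume X: "is_X_atom m n"
  then have "is_atom m n"
    by (simp add: is_X_atom_def)
  then have m: "1 \<le> m" "m \<le> n" "m = 1 \<or> atom_end (m - 1)" "atom_end n"
    and between: "\<And>i. m \<le> i \<Longrightarrow> i < n \<Longrightarrow> \<not> atom_end i"
    by (auto simp: is_atom_def)
  have "Suc n - m = 8"
    using X unfolding count_Allocated[symmetric] is_X_atom_def by simp
  then have n: "n = m + 7"
    using m(2) by simp
  show "\<exists>j\<ge>2. Suc j \<in> mu_values \<and> m = 12 * j + 1 \<and> n = 12 * j + 8"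
  proof (cases "25 \<le> m")
    case True
    define j where "j = (m - 1) div 12"
    define r where "r = (m - 1) mod 12"
    have "12 * j + r = m - 1" "r < 12"
      by (simp_all add: j_def r_def)
    then have mj: "m = 12 * j + r + 1" and r: "r < 12"
      using True by linarith+
    then have j: "2 \<le> j"
      using True by linarith
    have end_m: "atom_end (12 * j + r)"
      using m(3) True mj by auto
    show ?thesis
    proof (cases "r = 0")
      case True
      have "Suc j \<in> mu_values"
      proof (rule ccontr)
        assume "Suc j \<notin> mu_values"
        then have "atom_end (12 * j + 6)"
          using atom_end_in_block[OF j] by simp
        then show False
          using between[of "12 * j + 6"] mj n True by simp
      qed
      then show ?thesis
        using j mj n True by auto
    next
      case False
      \<comment> \<open>The atom would start after the end inside the block, and the next block
        boundary, itself an atom end, would fall strictly before its eighth term.\<close>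
      then have "6 \<le> r"
        using atom_end_in_block[OF j] end_m r by (auto split: if_splits dest!: bspec[of _ _ "12 * j + r"])
      moreover have "atom_end (12 * Suc j)"
        using atom_end_multiple[of "Suc j"] j by simp
      ultimately show ?thesis
        using between[of "12 * Suc j"] mj n r by simp
    qed
  next
    case False
    then have "m \<in> {1, 5, 9, 15, 21, 25}"
      using m(1,3) base_atom_end[of "m - 1"] by (auto simp: base_ends_def)
    then show ?thesis
      using False n between[of 4] between[of 8] between[of 14] between[of 20] between[of 24]
      by (auto simp: base_atom_end base_ends_def)
  qed
next
  assume "\<exists>j\<ge>2. Suc j \<in> mu_values \<and> m = 12 * j + 1 \<and> n = 12 * j + 8"
  then obtain j where j: "2 \<le> j" "Suc j \<in> mu_values" and mn: "m = 12 * j + 1" "n = 12 * j + 8"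
    by blast
  have "is_atom m n"
    using atom_end_multiple[OF j(1)] atom_end_in_block[OF j(1)] j(2) unfolding is_atom_def mn by auto
  then show "is_X_atom m n"
    using exceptional_code[OF j] unfolding is_X_atom_def mn by blast
qed

section \<open>The sequence \<open>mu\<close>\<close>

lemma infinite_mu_values: "infinite mu_values"
proof
  assume "finite mu_values"
  moreover have "range (\<lambda>i. 2 ^ i) \<subseteq> mu_values"
    by (auto simp: mu_values_def)
  moreover have "infinite (range (\<lambda>i. 2 ^ i :: nat))"
    by (intro range_inj_infinite injI) simp
  ultimately show False
    using finite_subset by blast
qed

lemma mu_eq_enumerate: "mu m = enumerate mu_values (m - 1)"
  by (simp add: mu_def mu_values_def)

lemma mu_values_eq: "mu_values = mu ` {1..}"
proof -
  have "v \<in> mu ` {1..}" if v: "v \<in> mu_values" for v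
  proof -
    obtain m where "v = enumerate mu_values m"
      using v range_enumerate[OF infinite_mu_values] by blast
    then have "v = mu (Suc m)"
      by (simp add: mu_eq_enumerate)
    then show ?thesis
      by simp
  qed
  moreover have "mu m \<in> mu_values" for m
    using enumerate_in_set[OF infinite_mu_values] by (simp add: mu_eq_enumerate)
  ultimately show ?thesis
    by auto
qed

lemma mu_less_iff: "1 \<le> m \<Longrightarrow> 1 \<le> m' \<Longrightarrow> mu m < mu m' \<longleftrightarrow> m < m'"
  unfolding mu_eq_enumerate enumerate_mono_iff[OF infinite_mu_values] by auto

lemma mu_Suc: "mu (Suc (Suc m)) = (LEAST v. v \<in> mu_values \<and> mu (Suc m) < v)"
  by (simp add: mu_eq_enumerate enumerate_Suc''[OF infinite_mu_values])

text \<open>The two kinds of values alternate: \<open>2 ^ (i + 1) < 3 * 2 ^ i < 2 ^ (i + 2)\<close>,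
  and comparing exponents shows that nothing of either kind lies in between.\<close>

lemma next_mu_values:
  "(LEAST v. v \<in> mu_values \<and> 2 ^ (i + 1) < v) = 3 * 2 ^ i"
  "(LEAST v. v \<in> mu_values \<and> 3 * 2 ^ i < v) = 2 ^ (i + 2)"
proof -
  have pow: "(2::nat) ^ i \<le> 2 ^ k" if "i \<le> k" for i k :: nat
    using that by (intro power_increasing) auto
  have mem: "3 * 2 ^ i \<in> mu_values" "2 ^ (i + 2) \<in> mu_values" for i
    unfolding mu_values_def by blast+
  show "(LEAST v. v \<in> mu_values \<and> 2 ^ (i + 1) < v) = 3 * 2 ^ i"
  proof (rule Least_equality)
    show "3 * 2 ^ i \<in> mu_values \<and> 2 ^ (i + 1) < 3 * (2::nat) ^ i"
      using mem by simp
  next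
    fix v assume v: "v \<in> mu_values \<and> 2 ^ (i + 1) < v"
    then consider k where "v = 2 ^ k" | k where "v = 3 * 2 ^ k"
      by (auto simp: mu_values_def)
    then show "3 * 2 ^ i \<le> v"
    proof cases
      case 1
      then have "i + 2 \<le> k"
        using v by (simp add: power_strict_increasing_iff del: power_Suc)
      then show ?thesis
        using 1 pow[of "i + 2" k] by simp
    next
      case 2
      have "i \<le> k"
      proof (rule ccontr)
        assume "\<not> i \<le> k"
        then have "Suc k \<le> i"
          by simp
        from pow[OF this] show False
          using v 2 by simp
      qed
      from pow[OF this] show ?thesis
        using 2 by simp
    qed
  qed
  show "(LEAST v. v \<in> mu_values \<and> 3 * 2 ^ i < v) = 2 ^ (i + 2)"
  proof (rule Least_equality)
    show "2 ^ (i + 2) \<in> mu_values \<and> 3 * 2 ^ i < (2::nat) ^ (i + 2)"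
      using mem(2)[of i] by (intro conjI) simp_all
  next
    fix v assume v: "v \<in> mu_values \<and> 3 * 2 ^ i < v"
    then consider k where "v = 2 ^ k" | k where "v = 3 * 2 ^ k"
      by (auto simp: mu_values_def)
    then show "2 ^ (i + 2) \<le> v"
    proof cases
      case 1
      have "i + 2 \<le> k"
      proof (rule ccontr)
        assume "\<not> i + 2 \<le> k"
        then have "k \<le> i + 1"
          by simp
        from pow[OF this] show False
          using v 1 by simp
      qed
      then show ?thesis
        using 1 pow[of "i + 2" k] by simp
    next
      case 2
      then have "Suc i \<le> k"
        using v by simp
      from pow[OF this] show ?thesis
        using 2 by simp
    qed
  qed
qed

lemma mu_closed_form: "mu (2 * i + 2) = 2 ^ (i + 1) \<and> mu (2 * i + 3) = 3 * 2 ^ i"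
proof (induction i)
  case 0
  have "mu 1 = (LEAST v. v \<in> mu_values)"
    by (simp add: mu_eq_enumerate enumerate_0)
  also have "\<dots> = 1"
    by (rule Least_equality) (auto simp: mu_values_def intro!: exI[of _ 0] Suc_leI)
  finally have "mu (Suc 0) = 1"
    by simp
  then have "mu 2 = (LEAST v. v \<in> mu_values \<and> 1 < v)"
    using mu_Suc[of 0] by (simp add: numeral_2_eq_2)
  also have "\<dots> = 2"
  proof (rule Least_equality)
    show "2 \<in> mu_values \<and> (1::nat) < 2"
      by (simp add: mem_mu_values)
  qed auto
  finally show ?case
    using mu_Suc[of 1] next_mu_values(1)[of 0] by (simp add: numeral_2_eq_2 numeral_3_eq_3)
next
  case (Suc i)
  have 1: "mu (2 * Suc i + 2) = 2 ^ (Suc i + 1)"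
    using mu_Suc[of "2 * i + 2"] Suc next_mu_values(2)[of i] by (simp add: eval_nat_numeral)
  then have "mu (2 * Suc i + 3) = 3 * 2 ^ Suc i"
    using mu_Suc[of "2 * i + 3"] next_mu_values(1)[of "Suc i"] by (simp add: eval_nat_numeral)
  with 1 show ?case
    by blast
qed

text \<open>Two places further is one doubling in the same chain. The index 1 is an exception, as
  \<open>mu 1 = 1\<close> and \<open>mu 3 = 3\<close>.\<close>

lemma mu_double:
  assumes "2 \<le> m"
  shows "mu (m + 2) = 2 * mu m"
proof -
  define i where "i = (m - 2) div 2"
  have "m = 2 * i + 2 \<or> m = 2 * i + 3"
    using assms unfolding i_def by presburger
  then show ?thesis
    using mu_closed_form[of i] mu_closed_form[of "Suc i"] by auto
qed

lemma mu_3: "mu 3 = 3"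
  using mu_closed_form[of 0] by simp

lemma three_dvd_mu_iff:
  assumes "3 \<le> m"
  shows "3 dvd mu m \<longleftrightarrow> odd m"
proof -
  have pow: "\<not> 3 dvd (2::nat) ^ i" for i
    by (induction i) (auto, presburger)
  define i where "i = (m - 2) div 2"
  have "m = 2 * i + 2 \<or> m = 2 * i + 3"
    using assms unfolding i_def by presburger
  then show ?thesis
    using mu_closed_form[of i] pow[of "i + 1"] by auto
qed

text \<open>The X atom in block \<open>j\<close> with \<open>Suc j = mu i\<close> starts at
  \<open>12 * j + 1 = 12 * mu i - 11\<close>. The least such block is \<open>j = 2\<close>, with
  \<open>i = 3\<close>. As the numbering starts with 2, the atom numbered \<open>k\<close> belongs
  to \<open>mu (k + 1)\<close>.\<close>

lemma card_earlier_X_atoms: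
  assumes "3 \<le> k"
  shows "card {m. m < 12 * mu k - 11 \<and> (\<exists>n. is_X_atom m n)} = k - 3"
proof -
  have "{m. m < 12 * mu k - 11 \<and> (\<exists>n. is_X_atom m n)} = (\<lambda>i. 12 * mu i - 11) ` {3..<k}"
  proof (intro subset_antisym subsetI)
    fix m assume "m \<in> {m. m < 12 * mu k - 11 \<and> (\<exists>n. is_X_atom m n)}"
    then obtain j where j: "2 \<le> j" "Suc j \<in> mu_values" "m = 12 * j + 1" "m < 12 * mu k - 11"
      unfolding is_X_atom_iff by auto
    then obtain i where i: "1 \<le> i" "Suc j = mu i"
      unfolding mu_values_eq by auto
    have "mu i < mu k" "mu 3 \<le> mu i"
      using j i(2) mu_3 by linarith+
    then have "i < k" "3 \<le> i"
      using mu_less_iff[of i k] mu_less_iff[of i 3] i(1) assms by (auto simp: not_less[symmetric])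
    moreover have "m = 12 * mu i - 11"
      using j(3) i(2) by linarith
    ultimately show "m \<in> (\<lambda>i. 12 * mu i - 11) ` {3..<k}"
      by auto
  next
    fix m assume "m \<in> (\<lambda>i. 12 * mu i - 11) ` {3..<k}"
    then obtain i where i: "3 \<le> i" "i < k" "m = 12 * mu i - 11"
      by auto
    have "mu i < mu k"
      using mu_less_iff[of i k] i by simp
    moreover have "3 \<le> mu i"
      using mu_less_iff[of i 3] i(1) mu_3 by simp
    moreover have "mu i \<in> mu_values"
      using i unfolding mu_values_eq by auto
    \<comment> \<open>The witnesses are the block \<open>mu i - 1\<close> and the last index
      \<open>12 * j + 8\<close> of its X atom.\<close>
    ultimately show "m \<in> {m. m < 12 * mu k - 11 \<and> (\<exists>n. is_X_atom m n)}"
      unfolding is_X_atom_iff using i(3)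
      by (auto intro!: exI[of _ "12 * mu i - 4"] exI[of _ "mu i - 1"])
  qed
  moreover have "inj_on (\<lambda>i. 12 * mu i - 11) {3..<k}"
  proof (rule linorder_inj_onI)
    fix i i' assume "i < i'" "i \<in> {3..<k}" "i' \<in> {3..<k}"
    then have "mu i < mu i'" "\<not> mu i < mu 3"
      using mu_less_iff by auto
    then show "12 * mu i - 11 \<noteq> 12 * mu i' - 11"
      using mu_3 by linarith
  qed auto
  ultimately show ?thesis
    by (simp add: card_image)
qed

lemma core_eq: "3 \<le> m \<Longrightarrow> core (mu m - 1) = (if odd m then 11 else 15)"
  using three_dvd_mu_iff[of m] mu_less_iff[of m 3] mu_3 by (simp add: core_def)

theorem theorem6p2:
  fixes k n x s :: nat
  assumes "k \<ge> 10"
    and "n = 12 * mu (k + 1) - 11"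
    and "x = mu (k - 1) - 1"
    and "s = (if even k then 11 else 15)"
  shows "X_atom k n (n + 7) \<and>
         two_up n = 2 ^ (4 * x + 2) + 2 ^ (8 * x + 5) \<and>
         two_up (n + 1) = 2 ^ (16 * x + 10) \<and>
         two_up (n + 2) = 2 ^ (16 * x + 11) \<and>
         two_up (n + 3) = 2 ^ (16 * x + 12) \<and>
         two_up (n + 4) = 2 ^ x + 2 ^ (8 * x + 6) \<and>
         two_up (n + 5) = 2 ^ (16 * x + 13) \<and>
         two_up (n + 6) = 2 ^ (2 * x + 1) + 2 ^ (4 * x + 3) \<and>
         two_up (n + 7) = 2 ^ (16 * x + 14) \<and>
         two_up (n + 8) = 2 ^ s + 2 ^ (8 * x + 7)"
proof -
  \<comment> \<open>\<open>j\<close> is the block containing the atom: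
    \<open>Suc j = mu (k + 1) = 2 * mu (k - 1) = 2 * Suc x\<close>. Thus \<open>x\<close> precedes
    \<open>j\<close> in its chain.\<close>
  define j where "j = 2 * x + 1"
  \<comment> \<open>Since \<open>mu 9 = 24\<close>, this gives \<open>x \<ge> 23\<close> and so
    \<open>lead x = x\<close>. For \<open>k = 9\<close> one would have \<open>x = 15\<close> but
    \<open>lead 15 = 7\<close>.\<close>
  have "mu 9 \<le> mu (k - 1)"
    using assms(1) by (intro leI) (simp add: mu_less_iff)
  then have x: "23 \<le> x" "mu (k - 1) = Suc x"
    using mu_closed_form[of 3] assms(3) by simp_all
  have mu: "mu (k + 1) = Suc j"
    using mu_double[of "k - 1"] assms(1) x(2) by (simp add: j_def)
  then have mem: "Suc j \<in> mu_values"
    unfolding mu_values_eq by (metis atLeast_iff image_eqI le_add2)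
  have n: "n = 12 * j + 1"
    using assms(2) mu by simp
  have j: "8 \<le> j"
    using x(1) by (simp add: j_def)
  have core: "core j = s"
    using core_eq[of "k + 1"] assms(1,4) mu by simp
  have lead: "lead (j div 2) = x" "lead j = j"
    using x(1) by (simp_all add: lead_def j_def)
  note step = exceptional_step[OF _ _ j mem, unfolded core lead]
  have st: "full_state (12 * j) {carry j, 4 * j + 1} (8 * j + 2) (4 * j + 1)" "\<forall>i\<in>{8..<2 * j}. half i"
    using block_state[OF j] by auto
  have reg: "two_up (12 * j + 2) = 2 ^ (8 * j + 2)" "two_up (12 * j + 3) = 2 ^ (8 * j + 3)"
    "two_up (12 * j + 4) = 2 ^ (8 * j + 4)" "two_up (12 * j + 6) = 2 ^ (8 * j + 5)"
    using step(3)[OF st] unfolding reg_half_def double_index by auto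
  \<comment> \<open>The third term of this half is already the one after the atom; it brings in the
    exponent \<open>s\<close>.\<close>
  have exc: "two_up (12 * j + 7) = pair j (2 * j + 1)" "two_up (12 * j + 8) = 2 ^ (8 * j + 6)"
    "two_up (12 * j + 9) = pair s (4 * j + 3)"
    using step(4)[OF st] unfolding exc_half_def double_index by auto
  have index: "12 * j + 1 + 1 = 12 * j + 2" "12 * j + 1 + 2 = 12 * j + 3" "12 * j + 1 + 3 = 12 * j + 4"
    "12 * j + 1 + 4 = 12 * j + 5" "12 * j + 1 + 5 = 12 * j + 6" "12 * j + 1 + 6 = 12 * j + 7"
    "12 * j + 1 + 7 = 12 * j + 8" "12 * j + 1 + 8 = 12 * j + 9"
    by simp_all
  have exponents: "4 * j + 1 = 8 * x + 5" "8 * j + 2 = 16 * x + 10"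
    "8 * j + 3 = 16 * x + 11" "8 * j + 4 = 16 * x + 12" "4 * j + 2 = 8 * x + 6" "8 * j + 5 = 16 * x + 13"
    "2 * j + 1 = 4 * x + 3" "8 * j + 6 = 16 * x + 14" "4 * j + 3 = 8 * x + 7"
    by (simp_all add: j_def)
  have "is_X_atom n (n + 7)"
    unfolding is_X_atom_iff using j mem n by (intro exI[of _ j]) simp
  moreover have "k = 2 + card {m'. m' < n \<and> (\<exists>n'. is_X_atom m' n')}"
    using card_earlier_X_atoms[of "k + 1"] assms(1,2) by simp
  ultimately have "X_atom k n (n + 7)"
    unfolding X_atom_def by blast
  moreover have "two_up (12 * j + 1) = pair (4 * x + 2) (4 * j + 1)"
    using step(1)[OF st] by (simp add: j_def)
  moreover have "two_up (12 * j + 7) = pair (2 * x + 1) (2 * j + 1)"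
    using exc(1) unfolding j_def[symmetric] .
  ultimately show ?thesis
    using step(2)[OF st] reg exc(2,3) unfolding n index exponents pair_def by blast
qed

end
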